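(* For any $M,N\ge0$ and $u_1,\dots,u_M,v_1,\dots,v_N\in\mathbb{C}$ such that $$\left|\frac{u_i-s}{1-su_i}\cdot\frac{v_j-s}{1-sv_j}\right|<1,\qquad 1\le i\le M,\ 1\le j\le N,$$ we have $$\frac{\prod_{i=1}^M(1-su_i)}{(q;q)_M}\sum_{\nu\in\mathrm{Sign}_M^+}F_\nu(u_1,\dots,u_M)\,G^c_\nu(v_1,\dots,v_N)=\prod_{\substack{1\le i\le M\\1\le j\le N}}\frac{1-qu_iv_j}{1-u_iv_j}.$$
   Context: Throughout, $q,s$ are fixed generic complex parameters, and variables are such that no denominator vanishes. $(a;q)_n=\prod_{r=0}^{n-1}(1-aq^r)$ for $n\ge1$, $(a;q)_0=1$. Signatures: a signature of length $L$ is a string of integers $\lambda=(\lambda_1\ge\dots\ge\lambda_L)$; $\mathrm{Sign}_L$ is the set of all of them, $\mathrm{Sign}_L^+$ those with nonnegative entries; $\mathrm{Sign}_0=\mathrm{Sign}_0^+=\{\varnothing\}$. Multiplicative notation: $\lambda=0^{m_0}1^{m_1}2^{m_2}\cdots$ with $m_j=|\{i:\lambda_i=j\}|$. Vertex weights: for $u\in\mathbb{C}$ and integers $m\ge 0$, $w_u(m,0;m,0)=\frac{1-sq^mu}{1-su}$, $w_u(m,1;m,1)=\frac{u-sq^m}{1-su}$, $w_u(m+1,0;m,1)=\frac{(1-s^2q^m)u}{1-su}$, $w_u(m,1;m+1,0)=\frac{1-q^{m+1}}{1-su}$, and $w_u(i_1,j_1;i_2,j_2)=0$ for all other nonnegative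 integers. Path weights: in the square grid, assign to each vertex $(i,j)$ the variable $u_j$ (constant along rows). A vertex is interior to an up-right path if it lies on the path and is not its beginning or ending vertex. The weight of a finite collection of up-right paths is the product, over all vertices interior to the paths of the collection, of $w_{u_j}(i_1,j_1;i_2,j_2)$, where $i_1,j_1,i_2,j_2$ are the numbers of paths of the collection containing the South, West, North, East edge at the vertex (weight $1$ if there are no interior vertices). Two collections are identified if they have the same interior vertices and the same numbers $(i_1,j_1,i_2,j_2)$ at each of them. $F$: for $L\ge M\ge0$, $\lambda\in\mathrm{Sign}^+_L$, $\mu\in\mathrm{Sign}^+_M$, $F_{\lambda/\mu}(u_1,\dots,u_{L-M})$ is the sum of weights of all collections of $L$ up-right paths that start with the vertical edges $(\mu_m,0)\to(\mu_m,1)$, $1\le m\le M$, and the horizontal edges $(-1,j)\to(0,j)$, $1\le j\le L-M$, and end with the vertical edges $(\lambda_l,L-M)\to(\lambda_l,L-M+1)$, $1\le l\le L$. $F_\lambda:=F_{\lambda/\varnothing}$. $G$: for $L,k\ge0$, $\lambda,\nu\in\mathrm{Sign}_L$, $G_{\lambda/\nu}(u_1,\dots,u_k)$ is the sum of weights of all collections of $L$ up-right paths that start with the vertical edges $(\nu_n,0)\to(\nu_n,1)$, $1\le n\le L$, and end with the vertical edges $(\lambda_l,k)\to(\lambda_l,k+1)$, $1\le l\le L$. Conjugation: for $\nu=0^{n_0}1^{n_1}2^{n_2}\cdots$ put $c(\nu)=\prod_{k\ge0}\frac{(s^2;q)_{n_k}}{(q;q)_{n_k}}$, and $G^c_{\lambda/\mu}=\frac{c(\lambda)}{c(\mu)}G_{\lambda/\mu}$.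 For $\nu\in\mathrm{Sign}_M^+$, $G^c_\nu:=G^c_{\nu/(0,\dots,0)}$ (with $M$ zeros). *)

theory Defs
  imports "HOL-Analysis.Analysis" "HOL-Library.Multiset"
begin

definition qpoch :: "complex \<Rightarrow> complex \<Rightarrow> nat \<Rightarrow> complex" where
  "qpoch a q n = (\<Prod>r<n. 1 - a * q ^ r)"

definition Sign :: "nat \<Rightarrow> int list set" where
  "Sign L = {\<kappa>. length \<kappa> = L \<and> sorted_wrt (\<ge>) \<kappa>}"

definition Sign_plus :: "nat \<Rightarrow> int list set" where
  "Sign_plus L = {\<kappa> \<in> Sign L. \<forall>x\<in>set \<kappa>. 0 \<le> x}"

text \<open>\<^term>\<open>vertex_weight q s u i1 j1 i2 j2\<close> is $w_u(i_1,j_1;i_2,j_2)$; the arguments are the numbers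
  of paths through the South, West, North and East edges, in this order.\<close>

definition vertex_weight ::
  "complex \<Rightarrow> complex \<Rightarrow> complex \<Rightarrow> nat \<Rightarrow> nat \<Rightarrow> nat \<Rightarrow> nat \<Rightarrow> complex" where
  "vertex_weight q s u i1 j1 i2 j2 =
     (if j1 = 0 \<and> j2 = 0 \<and> i2 = i1 then (1 - s * q ^ i1 * u) / (1 - s * u)
      else if j1 = 1 \<and> j2 = 1 \<and> i2 = i1 then (u - s * q ^ i1) / (1 - s * u)
      else if j1 = 0 \<and> j2 = 1 \<and> i1 = i2 + 1 then (1 - s\<^sup>2 * q ^ i2) * u / (1 - s * u)
      else if j1 = 1 \<and> j2 = 0 \<and> i2 = i1 + 1 then (1 - q ^ (i1 + 1)) / (1 - s * u)
      else 0)"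

type_synonym vertex = "int \<times> int"
type_synonym edge = "vertex \<times> vertex"

text \<open>A path is the list of its vertices; it has at least one edge. Edges are directed up or right.\<close>

definition up_right_path :: "vertex list \<Rightarrow> bool" where
  "up_right_path p \<longleftrightarrow> 2 \<le> length p \<and>
     successively (\<lambda>a b. b = (fst a + 1, snd a) \<or> b = (fst a, snd a + 1)) p"

definition path_edges :: "vertex list \<Rightarrow> edge set" where
  "path_edges p = set (zip p (tl p))"

definition first_edge :: "vertex list \<Rightarrow> edge" where
  "first_edge p = (p ! 0, p ! 1)"

definition last_edge :: "vertex list \<Rightarrow> edge" where
  "last_edge p = (p ! (length p - 2), p ! (length p - 1))"

definition interior_vertices :: "vertex list \<Rightarrow> vertex set" where
  "interior_vertices p = set (butlast (tl p))"

text \<open>A collection of paths is a multiset of paths, and the prescribed first and last edges are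
  multisets as well, because signatures may have repeated entries. Which first edge is joined to
  which last edge is not prescribed.\<close>

definition path_collections :: "edge multiset \<Rightarrow> edge multiset \<Rightarrow> vertex list multiset set" where
  "path_collections A B =
     {C. (\<forall>p\<in>#C. up_right_path p) \<and> image_mset first_edge C = A \<and> image_mset last_edge C = B}"

definition edge_count :: "vertex list multiset \<Rightarrow> edge \<Rightarrow> nat" where
  "edge_count C e = size {#p \<in># C. e \<in> path_edges p#}"

type_synonym configuration = "vertex \<Rightarrow> (nat \<times> nat \<times> nat \<times> nat) option"

text \<open>The configuration of a collection is defined exactly at its interior vertices and records
  $(i_1,j_1,i_2,j_2)$ there. Two collections are identified iff their configurations are equal.\<close>

definition configuration_of :: "vertex list multiset \<Rightarrow> configuration" where
  "configuration_of C = (\<lambda>(x, y).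
     if (x, y) \<in> (\<Union>p\<in>set_mset C. interior_vertices p)
     then Some (edge_count C ((x, y - 1), (x, y)), edge_count C ((x - 1, y), (x, y)),
                edge_count C ((x, y), (x, y + 1)), edge_count C ((x, y), (x + 1, y)))
     else None)"

text \<open>The variable of row \<open>y\<close> is \<open>u (nat y)\<close>; all interior vertices of the collections below
  lie in rows \<open>y \<ge> 1\<close>.\<close>

definition configuration_weight ::
  "complex \<Rightarrow> complex \<Rightarrow> (nat \<Rightarrow> complex) \<Rightarrow> configuration \<Rightarrow> complex" where
  "configuration_weight q s u g =
     (\<Prod>a\<in>dom g. case the (g a) of (i1, j1, i2, j2) \<Rightarrow>
        vertex_weight q s (u (nat (snd a))) i1 j1 i2 j2)"

definition partition_function ::
  "complex \<Rightarrow> complex \<Rightarrow> (nat \<Rightarrow> complex) \<Rightarrow> edge multiset \<Rightarrow> edge multiset \<Rightarrow> complex" where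
  "partition_function q s u A B =
     (\<Sum>g\<in>configuration_of ` path_collections A B. configuration_weight q s u g)"

definition vertical_edges :: "int list \<Rightarrow> int \<Rightarrow> edge multiset" where
  "vertical_edges \<kappa> y = image_mset (\<lambda>x. ((x, y), (x, y + 1))) (mset \<kappa>)"

definition left_edges :: "nat \<Rightarrow> edge multiset" where
  "left_edges k = image_mset (\<lambda>j. ((- 1, int j), (0, int j))) (mset_set {1..k})"

text \<open>\<open>F_skew q s \<kappa> \<mu> u\<close> is $F_{\kappa/\mu}(u_1,\dots,u_{L-M})$, where \<open>L \<ge> M\<close> are the lengths of
  \<open>\<kappa>\<close> and \<open>\<mu>\<close>; only the values \<open>u 1, \<dots>, u (L - M)\<close> matter.\<close>

definition F_skew ::
  "complex \<Rightarrow> complex \<Rightarrow> int list \<Rightarrow> int list \<Rightarrow> (nat \<Rightarrow> complex) \<Rightarrow> complex" where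
  "F_skew q s \<kappa> \<mu> u =
     (let k = length \<kappa> - length \<mu>
      in partition_function q s u (vertical_edges \<mu> 0 + left_edges k) (vertical_edges \<kappa> (int k)))"

definition F :: "complex \<Rightarrow> complex \<Rightarrow> int list \<Rightarrow> (nat \<Rightarrow> complex) \<Rightarrow> complex" where
  "F q s \<kappa> u = F_skew q s \<kappa> [] u"

text \<open>\<open>G_skew q s \<kappa> \<nu> k v\<close> is $G_{\kappa/\nu}(v_1,\dots,v_k)$; only \<open>v 1, \<dots>, v k\<close> matter.\<close>

definition G_skew ::
  "complex \<Rightarrow> complex \<Rightarrow> int list \<Rightarrow> int list \<Rightarrow> nat \<Rightarrow> (nat \<Rightarrow> complex) \<Rightarrow> complex" where
  "G_skew q s \<kappa> \<nu> k v =
     partition_function q s v (vertical_edges \<nu> 0) (vertical_edges \<kappa> (int k))"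

text \<open>In the product defining $c(\nu)$ only the values occurring in \<open>\<nu>\<close> contribute, since
  $(a;q)_0 = 1$.\<close>

definition conj_factor :: "complex \<Rightarrow> complex \<Rightarrow> int list \<Rightarrow> complex" where
  "conj_factor q s \<nu> =
     (\<Prod>k\<in>set \<nu>. qpoch (s\<^sup>2) q (count_list \<nu> k) / qpoch q q (count_list \<nu> k))"

definition Gc_skew ::
  "complex \<Rightarrow> complex \<Rightarrow> int list \<Rightarrow> int list \<Rightarrow> nat \<Rightarrow> (nat \<Rightarrow> complex) \<Rightarrow> complex" where
  "Gc_skew q s \<kappa> \<mu> k v = conj_factor q s \<kappa> / conj_factor q s \<mu> * G_skew q s \<kappa> \<mu> k v"

definition Gc :: "complex \<Rightarrow> complex \<Rightarrow> int list \<Rightarrow> nat \<Rightarrow> (nat \<Rightarrow> complex) \<Rightarrow> complex" where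
  "Gc q s \<nu> k v = Gc_skew q s \<nu> (replicate (length \<nu>) 0) k v"

end

(* The identity is proved by transfer matrices. A row of the lattice is described by the numbers of
   vertical paths below and above it, as functions nat => nat of the column. Moving from left to
   right, the row is a product of 2x2 matrices acting on the horizontal edge.

   For one F-row with variable u and one conjugated G-row with variable v, the column transfer
   matrices of the two orders of the rows act on pairs of horizontal edges and are intertwined by
   an explicit 4x4 matrix (a form of the Yang-Baxter equation), whatever the numbers of vertical
   paths. This gives a one-row skew Cauchy identity, first for finitely many columns with an error
   term that decays like ((u - s) / (1 - s u) * (v - s) / (1 - s v))^n, then for all columns.
   Moving the G-rows through the F-rows one at a time produces the product on the right-hand side;
   when all of them have passed, only F of (0, ..., 0), i.e. (q; q)_M / prod (1 - s u_i), is left.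

   All exchanges of infinite sums are justified by geometric bounds alpha^|nu| on F and beta^|nu|
   on G, where alpha and beta slightly exceed all |u_i - s| / |1 - s u_i| and
   |v_j - s| / |1 - s v_j|, and alpha beta < 1. *)

theory Submission
  imports Defs
begin

subsection \<open>Rows as products of transfer matrices\<close>

text \<open>Conservation leaves at most one choice of horizontal edges between two given vertical
  occupations, so a row is a kernel on occupations. Paths matter only for showing that a collection
  yields such occupations, and that every family of occupations with nonzero weight comes from some
  collection. The factor of one exchange comes from the ends of the rows. On the left the pair (1,
  0), a path entering the F-row but none the G-row, is an eigenvector of the intertwining matrix
  with eigenvalue 1 - q u v. On the right the pair (0, 0) carries 1 - u v and the pair (1, 1)
  carries 1 - q. The pair (1, 1) is two paths running right together: the error term. The two
  occupations of a row play different roles: paths never move left, so the lower one is confined by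
  the upper one but not conversely. Sums over lower occupations are therefore finite, while sums
  over upper ones need convergence. The rates alpha and beta are strictly larger than the ratios
  because each further row uses up some of that room: the sum over the occupation between two rows
  decays like the quotient of the rates before and after.\<close>

text \<open>The factors $c(\lambda)/c(\mu)$ in the definition of $G^c$ can be distributed over the vertices of
  each row; the weights then need no denominators besides $1 - s u$.\<close>

definition conj_weight ::
  "complex \<Rightarrow> complex \<Rightarrow> complex \<Rightarrow> nat \<Rightarrow> nat \<Rightarrow> nat \<Rightarrow> nat \<Rightarrow> complex" where
  "conj_weight q s u i1 j1 i2 j2 =
     (if j1 = 0 \<and> j2 = 0 \<and> i2 = i1 then (1 - s * q ^ i1 * u) / (1 - s * u)
      else if j1 = 1 \<and> j2 = 1 \<and> i2 = i1 then (u - s * q ^ i1) / (1 - s * u)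
      else if j1 = 0 \<and> j2 = 1 \<and> i1 = i2 + 1 then (1 - q ^ i1) * u / (1 - s * u)
      else if j1 = 1 \<and> j2 = 0 \<and> i2 = i1 + 1 then (1 - s\<^sup>2 * q ^ i1) / (1 - s * u)
      else 0)"

text \<open>Conservation makes each horizontal occupation a function of the other three numbers, so
  at most one term survives in every step of a row. \<open>empty_vertex\<close> lets a row run
  through infinitely many empty columns.\<close>

locale ice_weight =
  fixes w :: "nat \<Rightarrow> nat \<Rightarrow> nat \<Rightarrow> nat \<Rightarrow> complex"
  assumes conserve: "w i1 j1 i2 j2 \<noteq> 0 \<Longrightarrow> i1 + j1 = i2 + j2"
    and horizontal_le: "w i1 j1 i2 j2 \<noteq> 0 \<Longrightarrow> j1 \<le> 1 \<and> j2 \<le> 1"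
    and empty_vertex: "w 0 0 0 0 = 1"

lemma ice_weight_vertex_weight: "1 - s * u \<noteq> 0 \<Longrightarrow> ice_weight (vertex_weight q s u)"
  by unfold_locales (auto simp: vertex_weight_def split: if_splits)

lemma ice_weight_conj_weight: "1 - s * u \<noteq> 0 \<Longrightarrow> ice_weight (conj_weight q s u)"
  by unfold_locales (auto simp: conj_weight_def split: if_splits)

text \<open>\<open>row_weight w e a k n j\<close> is the weight of the columns \<open>0, \<dots>, n - 1\<close> of a row with
  \<open>a x\<close> paths below and \<open>k x\<close> paths above column \<open>x\<close>, where \<open>e\<close> paths enter from the left and
  \<open>j\<close> paths leave to the right.\<close>

primrec row_weight :: "(nat \<Rightarrow> nat \<Rightarrow> nat \<Rightarrow> nat \<Rightarrow> complex) \<Rightarrow> nat \<Rightarrow> (nat \<Rightarrow> nat) \<Rightarrow> (nat \<Rightarrow> nat) \<Rightarrow> nat \<Rightarrow> nat \<Rightarrow> complex"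
  where
    "row_weight w e a k 0 = (\<lambda>j. of_bool (j = e))"
  | "row_weight w e a k (Suc n) =
       (\<lambda>j. row_weight w e a k n 0 * w (a n) 0 (k n) j + row_weight w e a k n 1 * w (a n) 1 (k n) j)"

lemma row_cong:
  "(\<And>x. x < n \<Longrightarrow> a x = a' x) \<Longrightarrow> (\<And>x. x < n \<Longrightarrow> k x = k' x) \<Longrightarrow>
    row_weight w e a k n j = row_weight w e a' k' n j"
  by (induction n arbitrary: j) auto

section \<open>Occupation functions: multiplicities of nonnegative signatures\<close>

definition occ_below :: "nat \<Rightarrow> nat \<Rightarrow> (nat \<Rightarrow> nat) set" where
  "occ_below L n = {f. (\<forall>x\<ge>n. f x = 0) \<and> (\<Sum>x<n. f x) = L}"

definition occs :: "nat \<Rightarrow> (nat \<Rightarrow> nat) set" where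
  "occs L = (\<Union>n. occ_below L n)"

text \<open>Past the support of both occupations only empty vertices remain, so every such cut-off
  gives the same value (\<open>row_total_eq\<close>) and \<open>LEAST\<close> merely selects one.
  The final \<open>0\<close> says that no path escapes to the right.\<close>

definition row_total ::
  "(nat \<Rightarrow> nat \<Rightarrow> nat \<Rightarrow> nat \<Rightarrow> complex) \<Rightarrow> nat \<Rightarrow> (nat \<Rightarrow> nat) \<Rightarrow> (nat \<Rightarrow> nat) \<Rightarrow> complex" where
  "row_total w e a k = row_weight w e a k (LEAST n. \<forall>x\<ge>n. a x = 0 \<and> k x = 0) 0"

lemma sum_below_extend:
  fixes f :: "nat \<Rightarrow> nat"
  assumes "\<forall>x\<ge>n. f x = 0" "n \<le> m"
  shows "(\<Sum>x<m. g x * f x) = (\<Sum>x<n. g x * f x)"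
  using assms by (intro sum.mono_neutral_right) auto

lemma occ_below_mono: "n \<le> m \<Longrightarrow> occ_below L n \<subseteq> occ_below L m"
  using sum_below_extend[of n _ m "\<lambda>_. 1"] by (auto simp: occ_below_def)

lemma occ_below_le:
  assumes "f \<in> occ_below L n" shows "f x \<le> L"
proof (cases "x < n")
  case True
  then have "f x \<le> (\<Sum>x<n. f x)" by (intro member_le_sum) auto
  then show ?thesis using assms by (auto simp: occ_below_def)
qed (use assms in \<open>auto simp: occ_below_def\<close>)

lemma occs_le: "f \<in> occs L \<Longrightarrow> f x \<le> L"
  using occ_below_le by (auto simp: occs_def)

lemma finite_bounded_functions: "finite {f::nat \<Rightarrow> nat. (\<forall>x\<ge>n. f x = 0) \<and> (\<forall>x. f x \<le> B)}"
proof (rule finite_subset)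
  show "{f::nat \<Rightarrow> nat. (\<forall>x\<ge>n. f x = 0) \<and> (\<forall>x. f x \<le> B)} \<subseteq>
     {f. \<forall>x. (x \<in> {..<n} \<longrightarrow> f x \<in> {..B}) \<and> (x \<notin> {..<n} \<longrightarrow> f x = 0)}" by auto
qed (intro finite_set_of_finite_funs; simp)

lemma finite_occ_below: "finite (occ_below L n)"
  by (rule finite_subset[OF _ finite_bounded_functions[of n L]])
    (use occ_below_le in \<open>auto simp: occ_below_def\<close>)

lemma occs_belowE:
  assumes "f \<in> occs L" obtains n where "f \<in> occ_below L n" "n \<ge> m"
  using assms occ_below_mono[of _ "max m _" L] unfolding occs_def
  by (metis UN_E max.cobounded1 max.cobounded2 subsetD)

lemma occ_below_occs: "f \<in> occ_below L n \<Longrightarrow> f \<in> occs L"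
  by (auto simp: occs_def)

lemma occs_belowI:
  assumes "f \<in> occs L" "\<And>x. x \<ge> n \<Longrightarrow> f x = 0"
  shows "f \<in> occ_below L n"
proof -
  obtain m where m: "f \<in> occ_below L m" "m \<ge> n" using occs_belowE[OF assms(1)] .
  then show ?thesis using sum_below_extend[of n f m "\<lambda>_. 1"] assms(2) by (auto simp: occ_below_def)
qed

text \<open>The sum of the entries of the signature, the exponent in all geometric bounds.\<close>

definition wt :: "(nat \<Rightarrow> nat) \<Rightarrow> nat" where
  "wt f = (\<Sum>x | f x \<noteq> 0. x * f x)"

lemma wt_below: "\<forall>x\<ge>n. f x = 0 \<Longrightarrow> wt f = (\<Sum>x<n. x * f x)"
  unfolding wt_def by (intro sum.mono_neutral_left) (auto intro: leI)

context ice_weight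
begin

text \<open>Add up conservation over the columns. The inequality for every prefix holds because the
  horizontal flux after \<open>m\<close> columns is nonnegative; it later serves as the criterion
  for realizing two occupations by paths.\<close>

lemma row_flux:
  assumes "row_weight w e a k n j \<noteq> 0" "e \<le> 1"
  shows "j \<le> 1 \<and> e + (\<Sum>x<n. a x) = (\<Sum>x<n. k x) + j \<and>
         (\<forall>m\<le>n. (\<Sum>x<m. k x) \<le> e + (\<Sum>x<m. a x))"
  using assms
proof (induction n arbitrary: j)
  case (Suc n)
  from Suc.prems(1) obtain i where i: "row_weight w e a k n i \<noteq> 0" "w (a n) i (k n) j \<noteq> 0"
    by (cases "row_weight w e a k n 0 * w (a n) 0 (k n) j = 0") auto
  note IH = Suc.IH[OF i(1) Suc.prems(2)]
  have "a n + i = k n + j" "j \<le> 1" using conserve[OF i(2)] horizontal_le[OF i(2)] by auto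
  then show ?case using IH by (auto simp: le_Suc_eq)
qed (auto split: if_splits)

lemma row_stable:
  assumes "\<forall>x\<ge>n. a x = 0 \<and> k x = 0" "n \<le> m"
  shows "row_weight w e a k m 0 = row_weight w e a k n 0"
  using assms(2)
proof (induction m rule: dec_induct)
  case (step m)
  \<comment> \<open>A path entering an empty column must leave it, so only the horizontal state
    \<open>0\<close> reaches the exit \<open>0\<close>.\<close>
  have "w 0 1 0 0 = 0" using conserve[of 0 1 0 0] by auto
  then show ?case using step assms(1) by (simp add: empty_vertex)
qed auto

lemma row_total_eq:
  assumes "\<forall>x\<ge>n. a x = 0 \<and> k x = 0"
  shows "row_total w e a k = row_weight w e a k n 0"
  unfolding row_total_def
proof (rule row_stable[symmetric])
  show "\<forall>x\<ge>(LEAST n. \<forall>x\<ge>n. a x = 0 \<and> k x = 0). a x = 0 \<and> k x = 0"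
    by (rule LeastI[of "\<lambda>n. \<forall>x\<ge>n. a x = 0 \<and> k x = 0", OF assms])
qed (rule Least_le, rule assms)

text \<open>Paths never move left: one that stands below column \<open>n\<close> or further right
  would have to leave the row there, where \<open>k\<close> is zero. Hence sums over the lower
  occupation of a row are in effect finite.\<close>

lemma row_total_support:
  assumes "row_total w e a k \<noteq> 0" "e \<le> 1" "a \<in> occs L" "k \<in> occ_below L' n"
  shows "a \<in> occ_below L n"
proof -
  obtain m where m: "a \<in> occ_below L m" "m \<ge> n" using occs_belowE assms(3) by blast
  have k: "k \<in> occ_below L' m" using assms(4) m(2) occ_below_mono by blast
  have "row_total w e a k = row_weight w e a k m 0"
    using m(1) k by (intro row_total_eq) (auto simp: occ_below_def)
  with assms row_flux[of e a k m 0] m(2)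
  have le: "(\<Sum>x<n. k x) \<le> e + (\<Sum>x<n. a x)" and eq: "e + (\<Sum>x<m. a x) = (\<Sum>x<m. k x)" by auto
  have "(\<Sum>x<m. k x) = (\<Sum>x<n. k x)" using assms(4) k by (auto simp: occ_below_def)
  with le eq have "(\<Sum>x<m. a x) \<le> (\<Sum>x<n. a x)" by simp
  moreover have "(\<Sum>x<m. a x) = (\<Sum>x<n. a x) + (\<Sum>x=n..<m. a x)"
    using m(2) by (metis finite_atLeastLessThan finite_lessThan ivl_disj_int_one(2) ivl_disj_un_one(2)
        sum.union_disjoint)
  ultimately have "\<forall>x\<in>{n..<m}. a x = 0" by simp
  then show ?thesis using m assms(3) by (intro occs_belowI) (auto simp: occ_below_def not_less)
qed

text \<open>Conservation telescopes: the sum of \<open>x * k x\<close> minus the sum of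
  \<open>x * a x\<close>, plus \<open>n * j\<close>, is the number of occupied East edges in the
  first \<open>n\<close> columns, and each of them pays one factor \<open>\<alpha>\<close>. The
  constant \<open>E\<close> is charged to vertical edges only.\<close>

lemma row_bound:
  assumes al: "\<alpha> > 0" and e: "e \<le> 1"
    and w: "\<And>i j i' j'. i \<le> B \<Longrightarrow> i' \<le> B \<Longrightarrow> norm (w i j i' j') \<le> E ^ (i + i') * \<alpha> ^ j'"
    and a: "\<And>x. a x \<le> B" and k: "\<And>x. k x \<le> B" and E: "E \<ge> 0"
  shows "norm (row_weight w e a k n j) * \<alpha> ^ (\<Sum>x<n. x * a x)
     \<le> E ^ (\<Sum>x<n. a x + k x) * \<alpha> ^ ((\<Sum>x<n. x * k x) + n * j)"
proof (induction n arbitrary: j)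
  case (Suc n)
  show ?case
  proof (cases "row_weight w e a k (Suc n) j = 0")
    case False
    then obtain i where i: "row_weight w e a k n i \<noteq> 0" "w (a n) i (k n) j \<noteq> 0"
      by (cases "row_weight w e a k n 0 * w (a n) 0 (k n) j = 0") auto
    have i1: "i \<le> 1" using horizontal_le[OF i(2)] by auto
    have oth: "w (a n) i' (k n) j = 0" if "i' \<noteq> i" for i'
      using conserve[OF i(2)] conserve[of "a n" i' "k n" j] that by auto
    have eq: "row_weight w e a k (Suc n) j = row_weight w e a k n i * w (a n) i (k n) j"
      using i1 oth by (cases i) auto
    \<comment> \<open>Conservation times \<open>n\<close> trades the exponent of the lower
      occupation for that of the upper one; the factor \<open>\<alpha> ^ j\<close> then turns
      \<open>n * j\<close> into \<open>Suc n * j\<close>.\<close>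
    have cons: "n * a n + n * i = n * k n + n * j"
      using conserve[OF i(2)] by (metis distrib_left)
    let ?X = "norm (row_weight w e a k n i) * \<alpha> ^ (\<Sum>x<n. x * a x)"
    let ?Y = "E ^ (\<Sum>x<n. a x + k x) * \<alpha> ^ ((\<Sum>x<n. x * k x) + n * i)"
    have "norm (row_weight w e a k (Suc n) j) * \<alpha> ^ (\<Sum>x<Suc n. x * a x)
        = ?X * (norm (w (a n) i (k n) j) * \<alpha> ^ (n * a n))"
      unfolding eq by (simp add: norm_mult power_add)
    also have "\<dots> \<le> ?Y * ((E ^ (a n + k n) * \<alpha> ^ j) * \<alpha> ^ (n * a n))"
      using al E a k by (intro mult_mono Suc.IH w) auto
    also have "\<dots> = E ^ (\<Sum>x<Suc n. a x + k x) * (\<alpha> ^ (\<Sum>x<n. x * k x) * \<alpha> ^ (n * a n + n * i) * \<alpha> ^ j)"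
      by (simp add: power_add mult_ac)
    also have "\<dots> = E ^ (\<Sum>x<Suc n. a x + k x) * \<alpha> ^ ((\<Sum>x<Suc n. x * k x) + Suc n * j)"
      unfolding cons by (simp add: power_add mult_ac)
    finally show ?thesis .
  qed (use al E in auto)
qed (use e al in auto)

text \<open>A constant at every vertex would grow with the number of columns, so \<open>E\<close>
  has the exponent \<open>i + i'\<close>, which is zero at a vertex without vertical paths. There a
  nonzero weight is \<open>1\<close> or \<open>w 0 1 0 1\<close>, both bounded by
  \<open>\<alpha> ^ j'\<close> without a constant.\<close>

lemma weight_bound:
  assumes al: "\<alpha> > 0" and le: "norm (w 0 1 0 1) \<le> \<alpha>"
  obtains E :: real where "E \<ge> 1"
    "\<And>i j i' j'. i \<le> B \<Longrightarrow> i' \<le> B \<Longrightarrow> norm (w i j i' j') \<le> E ^ (i + i') * \<alpha> ^ j'"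
proof -
  define D where "D = (\<Sum>(i,j,i',j')\<in>{..B}\<times>{..1}\<times>{..B}\<times>{..1}. norm (w i j i' j') / \<alpha> ^ j')"
  have D: "norm (w i j i' j') \<le> D * \<alpha> ^ j'" if "i \<le> B" "j \<le> 1" "i' \<le> B" "j' \<le> 1" for i j i' j'
  proof -
    have "norm (w i j i' j') / \<alpha> ^ j' \<le> D"
      unfolding D_def
      using member_le_sum[of "(i,j,i',j')" "{..B}\<times>{..1}\<times>{..B}\<times>{..1::nat}"
          "\<lambda>(i,j,i',j'). norm (w i j i' j') / \<alpha> ^ j'"] that al by force
    then show ?thesis using al by (simp add: divide_simps)
  qed
  show thesis
  proof (rule that[of "max 1 D"])
    fix i j i' j' assume B: "i \<le> B" "i' \<le> B"
    show "norm (w i j i' j') \<le> max 1 D ^ (i + i') * \<alpha> ^ j'"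
    proof (cases "w i j i' j' = 0")
      case False
      note h = conserve[OF this] horizontal_le[OF this]
      show ?thesis
      proof (cases "i + i' = 0")
        case True
        then have "j = j'" "j = 0 \<or> j = 1" using h by auto
        then show ?thesis using True le by (auto simp: empty_vertex)
      next
        case f: False
        have "norm (w i j i' j') \<le> D * \<alpha> ^ j'" using D B h by blast
        also have "\<dots> \<le> max 1 D ^ (i + i') * \<alpha> ^ j'"
        proof (rule mult_right_mono)
          have "D \<le> max 1 D ^ 1" by simp
          also have "\<dots> \<le> max 1 D ^ (i + i')" using f by (intro power_increasing) auto
          finally show "D \<le> max 1 D ^ (i + i')" .
        qed (use al in auto)
        finally show ?thesis .
      qed
    qed (use al in auto)
  qed auto
qed

lemma row_total_bound:
  assumes al: "\<alpha> > 0" and le: "norm (w 0 1 0 1) \<le> \<alpha>" and e: "e \<le> 1"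
  shows "\<exists>C>0. \<forall>a\<in>occs L. \<forall>k\<in>occs L'. norm (row_total w e a k) * \<alpha> ^ wt a \<le> C * \<alpha> ^ wt k"
proof -
  obtain E :: real where E: "E \<ge> 1"
    "\<And>i j i' j'. i \<le> max L L' \<Longrightarrow> i' \<le> max L L' \<Longrightarrow> norm (w i j i' j') \<le> E ^ (i + i') * \<alpha> ^ j'"
    using weight_bound[OF al le, of "max L L'"] by blast
  have "norm (row_total w e a k) * \<alpha> ^ wt a \<le> E ^ (L + L') * \<alpha> ^ wt k"
    if ak: "a \<in> occs L" "k \<in> occs L'" for a k
  proof -
    obtain n' where "a \<in> occ_below L n'" using ak occs_belowE by blast
    moreover obtain n where n: "k \<in> occ_below L' n" "n \<ge> n'" using ak occs_belowE by blast
    ultimately have a: "a \<in> occ_below L n" using occ_below_mono by blast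
    have z: "\<forall>x\<ge>n. a x = 0" "\<forall>x\<ge>n. k x = 0" using a n by (auto simp: occ_below_def)
    have *: "row_total w e a k = row_weight w e a k n 0" using z by (intro row_total_eq) auto
    have s: "(\<Sum>x<n. a x + k x) = L + L'" using a n by (auto simp: occ_below_def sum.distrib)
    show ?thesis
      unfolding * wt_below[OF z(1)] wt_below[OF z(2)] s[symmetric]
      using row_bound[where a = a and k = k and n = n and j = 0 and B = "max L L'", OF al e E(2)]
        occs_le[OF ak(1)] occs_le[OF ak(2)] E(1)
      by (simp add: le_max_iff_disj)
  qed
  then show ?thesis using E(1) by (intro exI[of _ "E ^ (L + L')"]) auto
qed

end

lemma summable_on_times_nonneg:
  fixes f :: "'a \<Rightarrow> real" and g :: "'b \<Rightarrow> real"
  assumes "f summable_on A" "g summable_on B"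
    and "\<And>x. x \<in> A \<Longrightarrow> f x \<ge> 0" "\<And>y. y \<in> B \<Longrightarrow> g y \<ge> 0"
  shows "(\<lambda>p. f (fst p) * g (snd p)) summable_on A \<times> B"
proof (rule summable_on_SigmaI)
  fix x assume "x \<in> A"
  show "((\<lambda>y. f (fst (x, y)) * g (snd (x, y))) has_sum f x * infsum g B) B"
    using has_sum_cmult_right[OF has_sum_infsum[OF assms(2)]] by simp
qed (use assms in \<open>auto intro!: summable_on_cmult_left\<close>)

lemma summable_on_wt:
  fixes r :: real
  assumes "0 \<le> r" "r < 1"
  shows "(\<lambda>f. r ^ wt f) summable_on occs L"
proof (induction L)
  case 0
  have "occs 0 \<subseteq> {\<lambda>_. 0}" using occs_le by fastforce
  then show ?case by (meson finite.simps finite_subset summable_on_finite)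
next
  case (Suc L)
  define \<phi> :: "nat \<times> (nat \<Rightarrow> nat) \<Rightarrow> nat \<Rightarrow> nat" where "\<phi> = (\<lambda>(x, f). f(x := Suc (f x)))"
  have "occs (Suc L) \<subseteq> \<phi> ` (UNIV \<times> occs L)"
  proof
    fix f assume "f \<in> occs (Suc L)"
    then obtain n where f: "f \<in> occ_below (Suc L) n" using occs_belowE by blast
    then have "(\<Sum>x<n. f x) \<noteq> 0" by (auto simp: occ_below_def)
    then obtain x where x: "x < n" "f x \<noteq> 0" by auto
    define g where "g = f(x := f x - 1)"
    have "(\<Sum>x<n. f x) = f x + (\<Sum>y\<in>{..<n}-{x}. f y)" using x by (intro sum.remove) auto
    moreover have "(\<Sum>x<n. g x) = g x + (\<Sum>y\<in>{..<n}-{x}. g y)" using x by (intro sum.remove) auto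
    moreover have "(\<Sum>y\<in>{..<n}-{x}. g y) = (\<Sum>y\<in>{..<n}-{x}. f y)"
      by (intro sum.cong) (auto simp: g_def)
    ultimately have "g \<in> occ_below L n" using f x by (auto simp: occ_below_def g_def)
    moreover have "f = \<phi> (x, g)" using x by (auto simp: \<phi>_def g_def)
    ultimately show "f \<in> \<phi> ` (UNIV \<times> occs L)" using occ_below_occs by blast
  qed
  then obtain U where U: "U \<subseteq> UNIV \<times> occs L" "inj_on \<phi> U" "occs (Suc L) = \<phi> ` U"
    by (meson subset_image_inj)
  have wt: "wt (\<phi> (x, f)) = x + wt f" if fL: "f \<in> occs L" for x f
  proof -
    obtain n where f: "f \<in> occ_below L n" "n \<ge> Suc x" by (rule occs_belowE[OF fL])
    have "wt (\<phi> (x, f)) = (\<Sum>y<n. y * \<phi> (x, f) y)"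
      using f by (intro wt_below) (auto simp: \<phi>_def occ_below_def)
    also have "\<dots> = (\<Sum>y<n. y * f y + (if y = x then y else 0))"
      by (intro sum.cong) (auto simp: \<phi>_def)
    also have "\<dots> = x + wt f"
      using f wt_below[of n f] by (simp add: sum.distrib occ_below_def)
    finally show ?thesis .
  qed
  have "(\<lambda>x. r ^ x) summable_on (UNIV :: nat set)"
    using assms by (subst summable_on_UNIV_nonneg_real_iff) (auto intro: summable_geometric)
  then have "(\<lambda>p. r ^ fst p * r ^ wt (snd p)) summable_on UNIV \<times> occs L"
    by (rule summable_on_times_nonneg[OF _ Suc.IH]) (use assms in auto)
  then have "(\<lambda>p. r ^ fst p * r ^ wt (snd p)) summable_on U"
    using U(1) summable_on_subset_banach by blast
  then have "((\<lambda>f. r ^ wt f) \<circ> \<phi>) summable_on U"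
    by (rule summable_on_cong[THEN iffD1, rotated]) (use U(1) wt in \<open>auto simp: power_add\<close>)
  then show ?case unfolding U(3) using summable_on_reindex[OF U(2), of "\<lambda>f. r ^ wt f"] by simp
qed

subsection \<open>The intertwining relation\<close>

lemma vertex_weight_simps:
  "vertex_weight q s u a 0 m 0 = (if m = a then (1 - s * q ^ a * u) / (1 - s * u) else 0)"
  "vertex_weight q s u a (Suc 0) m (Suc 0) = (if m = a then (u - s * q ^ a) / (1 - s * u) else 0)"
  "vertex_weight q s u a 0 m (Suc 0) = (if a = Suc m then (1 - s\<^sup>2 * q ^ m) * u / (1 - s * u) else 0)"
  "vertex_weight q s u a (Suc 0) m 0 = (if m = Suc a then (1 - q ^ Suc a) / (1 - s * u) else 0)"
  by (simp_all add: vertex_weight_def)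

lemma conj_weight_simps:
  "conj_weight q s u a 0 m 0 = (if m = a then (1 - s * q ^ a * u) / (1 - s * u) else 0)"
  "conj_weight q s u a (Suc 0) m (Suc 0) = (if m = a then (u - s * q ^ a) / (1 - s * u) else 0)"
  "conj_weight q s u a 0 m (Suc 0) = (if a = Suc m then (1 - q ^ Suc m) * u / (1 - s * u) else 0)"
  "conj_weight q s u a (Suc 0) m 0 = (if m = Suc a then (1 - s\<^sup>2 * q ^ a) / (1 - s * u) else 0)"
  by (simp_all add: conj_weight_def)

lemma sum_single:
  fixes X :: "nat \<Rightarrow> 'a :: semiring_0"
  shows "(\<Sum>m\<le>B. (if m = c then f m else 0) * X m) = (if c \<le> B then f c * X c else 0)"
    and "(\<Sum>m\<le>B. (if c = m then f m else 0) * X m) = (if c \<le> B then f c * X c else 0)"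
    and "(\<Sum>m\<le>B. (if c = Suc m then f m else 0) * X m) =
      (case c of 0 \<Rightarrow> 0 | Suc d \<Rightarrow> if d \<le> B then f d * X d else 0)"
  by (simp_all add: if_distrib[of "\<lambda>x. x * _"] split: nat.split cong: if_cong)

locale two_weights =
  fixes q s u v :: complex
  assumes su: "1 - s * u \<noteq> 0" and sv: "1 - s * v \<noteq> 0"
begin

text \<open>\<open>up\<close> and \<open>down\<close> are the contributions of one column to the two
  sides of the skew Cauchy identity: the summed occupation \<open>m\<close> lies above both
  \<open>a\<close> and \<open>b\<close> in \<open>up\<close> and below both in \<open>down\<close>.
  For \<open>a, b < B\<close> the cut-off loses nothing, since \<open>m\<close> differs from
  \<open>a\<close> by at most one.\<close>

definition up :: "nat \<Rightarrow> nat \<Rightarrow> nat \<Rightarrow> nat \<Rightarrow> nat \<Rightarrow> nat \<Rightarrow> nat \<Rightarrow> complex" where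
  "up B a b j i j' i' = (\<Sum>m\<le>B. vertex_weight q s u a j m j' * conj_weight q s v b i m i')"

definition down :: "nat \<Rightarrow> nat \<Rightarrow> nat \<Rightarrow> nat \<Rightarrow> nat \<Rightarrow> nat \<Rightarrow> nat \<Rightarrow> complex" where
  "down B a b j i j' i' = (\<Sum>m\<le>B. vertex_weight q s u m j b j' * conj_weight q s v m i a i')"

text \<open>The matrix intertwining the two orders of the rows, with entries indexed by pairs of
  horizontal occupations; it preserves the difference of the two occupations.\<close>

definition cross :: "nat \<Rightarrow> nat \<Rightarrow> nat \<Rightarrow> nat \<Rightarrow> complex" where
  "cross j i j' i' =
     (if j = 0 \<and> i = 0 \<and> j' = 0 \<and> i' = 0 then 1 - u * v
      else if j = 0 \<and> i = 0 \<and> j' = 1 \<and> i' = 1 then u * v * (1 - q)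
      else if j = 1 \<and> i = 1 \<and> j' = 0 \<and> i' = 0 then 1 - q
      else if j = 1 \<and> i = 1 \<and> j' = 1 \<and> i' = 1 then q * (1 - u * v)
      else if j \<noteq> i \<and> j' = j \<and> i' = i then 1 - q * u * v
      else 0)"

lemma intertwine:
  assumes B: "a < B" "b < B" and "j \<in> {0,1}" "i \<in> {0,1}" "j' \<in> {0,1}" "i' \<in> {0,1}"
  shows "(\<Sum>x\<in>{0,1}. \<Sum>y\<in>{0,1}. up B a b j i x y * cross x y j' i') =
         (\<Sum>x\<in>{0,1}. \<Sum>y\<in>{0,1}. cross j i x y * down B a b x y j' i')"
proof -
  \<comment> \<open>With the inverses as symbols every term carries the factor
    \<open>iu * iv\<close> and the rest is polynomial, so each case is a ring identity.\<close>
  define iu where "iu = inverse (1 - s * u)"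
  define iv where "iv = inverse (1 - s * v)"
  note ws = up_def down_def cross_def vertex_weight_simps[where s = s and u = u, unfolded divide_inverse, folded iu_def]
    conj_weight_simps[where s = s and u = v, unfolded divide_inverse, folded iv_def] sum_single
  have bits: "j = 0 \<or> j = Suc 0" "i = 0 \<or> i = Suc 0" "j' = 0 \<or> j' = Suc 0" "i' = 0 \<or> i' = Suc 0"
    using assms(3-6) by auto
  \<comment> \<open>Nonzero terms need \<open>m\<close> within distance one of both \<open>a\<close>
    and \<open>b\<close>, so both sides vanish once these differ by more than two. For difference at
    most one, the case of a smaller occupation \<open>0\<close> is separate because \<open>m\<close>
    cannot lie below it.\<close>
  consider "a = b" "a = 0" | c where "a = Suc c" "b = Suc c" | "a = Suc 0" "b = 0"
    | c where "a = Suc (Suc c)" "b = Suc c" | "b = Suc 0" "a = 0"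
    | c where "b = Suc (Suc c)" "a = Suc c" | "a = Suc (Suc b)" | "b = Suc (Suc a)"
    | "a > Suc (Suc b)" | "b > Suc (Suc a)"
    by atomize_elim presburger
  then show ?thesis
  proof cases
    case 1 with bits B show ?thesis
      apply (elim disjE)
      apply (simp_all add: ws)
      apply (simp_all add: algebra_simps power2_eq_square)
      done
  next
    case 2 with bits B show ?thesis
      apply (elim disjE)
      apply (simp_all add: ws)
      apply (simp_all add: algebra_simps power2_eq_square)
      done
  next
    case 3 with bits B show ?thesis
      apply (elim disjE)
      apply (simp_all add: ws)
      apply (simp_all add: algebra_simps power2_eq_square)
      done
  next
    case 4 with bits B show ?thesis
      apply (elim disjE)
      apply (simp_all add: ws)
      apply (simp_all add: algebra_simps power2_eq_square)
      done
  next
    case 5 with bits B show ?thesis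
      apply (elim disjE)
      apply (simp_all add: ws)
      apply (simp_all add: algebra_simps power2_eq_square)
      done
  next
    case 6 with bits B show ?thesis
      apply (elim disjE)
      apply (simp_all add: ws)
      apply (simp_all add: algebra_simps power2_eq_square)
      done
  next
    case 7 with bits B show ?thesis
      by (elim disjE) (simp_all add: ws split: nat.split)
  next
    case 8 with bits B show ?thesis
      by (elim disjE) (simp_all add: ws split: nat.split)
  next
    case 9 with bits B show ?thesis
      by (elim disjE) (simp_all add: ws split: nat.split)
  next
    case 10 with bits B show ?thesis
      by (elim disjE) (simp_all add: ws split: nat.split)
  qed
qed

end

subsection \<open>The skew Cauchy identity for single rows\<close>

text \<open>Bounding each column instead of prescribing the total makes this a product set, so sums
  over it factor into transfer matrices. Occupations with the wrong total drop out once no path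
  leaves the G-row on the right.\<close>

definition bounded_occs :: "nat \<Rightarrow> nat \<Rightarrow> (nat \<Rightarrow> nat) set" where
  "bounded_occs B n = {f. (\<forall>x\<ge>n. f x = 0) \<and> (\<forall>x. f x \<le> B)}"

lemma finite_bounded_occs: "finite (bounded_occs B n)"
  unfolding bounded_occs_def by (rule finite_bounded_functions)

lemma sum_bounded_occs_Suc:
  "(\<Sum>k\<in>bounded_occs B (Suc n). g k) = (\<Sum>k\<in>bounded_occs B n. \<Sum>m\<le>B. g (k(n := m)))"
proof -
  have "(\<Sum>k\<in>bounded_occs B (Suc n). g k) = (\<Sum>(k, m)\<in>bounded_occs B n \<times> {..B}. g (k(n := m)))"
    by (rule sum.reindex_bij_witness[where i = "\<lambda>(k, m). k(n := m)" and j = "\<lambda>k. (k(n := 0), k n)"])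
      (auto simp: bounded_occs_def Suc_le_eq fun_eq_iff)
  then show ?thesis by (simp add: sum.cartesian_product)
qed

text \<open>In matrix form \<open>A Q = c D\<close> and \<open>T Q = Q T'\<close> give
  \<open>(A T) Q = A Q T' = c (D T')\<close>, the induction step from \<open>n\<close> to
  \<open>n + 1\<close> columns.\<close>

lemma matrix_intertwine_step:
  fixes A D :: "'i \<Rightarrow> complex"
  assumes "\<And>t. t \<in> S \<Longrightarrow> (\<Sum>r\<in>S. A r * Q r t) = c * D t"
    and "\<And>r t. r \<in> S \<Longrightarrow> t \<in> S \<Longrightarrow> (\<Sum>x\<in>S. T r x * Q x t) = (\<Sum>x\<in>S. Q r x * T' x t)"
    and "t \<in> S"
  shows "(\<Sum>x\<in>S. (\<Sum>r\<in>S. A r * T r x) * Q x t) = c * (\<Sum>x\<in>S. D x * T' x t)"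
proof -
  have "(\<Sum>x\<in>S. (\<Sum>r\<in>S. A r * T r x) * Q x t) = (\<Sum>r\<in>S. A r * (\<Sum>x\<in>S. T r x * Q x t))"
    unfolding sum_distrib_left sum_distrib_right by (subst sum.swap) (simp add: mult_ac)
  also have "\<dots> = (\<Sum>r\<in>S. A r * (\<Sum>x\<in>S. Q r x * T' x t))"
    using assms(2,3) by (intro sum.cong) auto
  also have "\<dots> = (\<Sum>x\<in>S. (\<Sum>r\<in>S. A r * Q r x) * T' x t)"
    unfolding sum_distrib_left sum_distrib_right by (subst sum.swap) (simp add: mult_ac)
  also have "\<dots> = (\<Sum>x\<in>S. c * D x * T' x t)"
    using assms(1) by (intro sum.cong) auto
  finally show ?thesis by (simp add: sum_distrib_left mult_ac)
qed

lemma tendsto_sum_occ_below: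
  fixes f :: "(nat \<Rightarrow> nat) \<Rightarrow> 'a :: {comm_monoid_add, t2_space}"
  assumes "f summable_on occs L"
  shows "(\<lambda>n. sum f (occ_below L n)) \<longlonglongrightarrow> infsum f (occs L)"
proof (rule filterlim_compose[OF infsum_tendsto[OF assms]])
  show "filterlim (occ_below L) (finite_subsets_at_top (occs L)) sequentially"
    unfolding filterlim_finite_subsets_at_top
  proof (intro allI impI)
    fix X assume X: "finite X \<and> X \<subseteq> occs L"
    have "\<forall>f\<in>X. \<exists>n. f \<in> occ_below L n" using X by (auto simp: occs_def)
    then obtain n where n: "\<And>f. f \<in> X \<Longrightarrow> f \<in> occ_below L (n f)" by metis
    have "X \<subseteq> occ_below L m" if "m \<ge> Max (insert 0 (n ` X))" for m
    proof
      fix f assume "f \<in> X"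
      then have "n f \<le> m" using X that by (auto intro: order_trans[OF Max_ge])
      then show "f \<in> occ_below L m" using n[OF \<open>f \<in> X\<close>] occ_below_mono by blast
    qed
    then show "\<forall>\<^sub>F m in sequentially. finite (occ_below L m) \<and> X \<subseteq> occ_below L m \<and> occ_below L m \<subseteq> occs L"
      using finite_occ_below occ_below_occs unfolding eventually_sequentially by blast
  qed
qed

lemma exists_larger_factors:
  fixes a b :: real
  assumes "a \<ge> 0" "b \<ge> 0" "a * b < 1"
  obtains \<alpha> \<beta> where "\<alpha> > a" "\<beta> > b" "\<alpha> * \<beta> < 1"
proof -
  \<comment> \<open>\<open>(a + t) * (b + t) = a * b + t * (a + b + t)\<close>, and as
    \<open>t \<le> 1\<close> this choice keeps the increment at most half of the gap
    \<open>1 - a * b\<close>.\<close>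
  define t where "t = (1 - a * b) / (2 * (a + b + 1))"
  have ab: "a + b + 1 \<ge> 1" "a * b \<ge> 0" using assms by auto
  have t: "t > 0" using assms ab by (auto simp: t_def)
  have "t \<le> 1" using ab by (simp add: t_def)
  then have "t * (a + b + t) \<le> t * (a + b + 1)" using t by (intro mult_left_mono) auto
  also have "\<dots> = (1 - a * b) / 2" using ab by (simp add: t_def field_simps)
  also have "\<dots> < 1 - a * b" using assms by simp
  finally have "(a + t) * (b + t) < 1" by (simp add: algebra_simps)
  then show thesis using that[of "a + t" "b + t"] t by simp
qed

section \<open>Two rows on finitely many columns\<close>

context two_weights
begin

sublocale W: ice_weight "vertex_weight q s u" using su by (rule ice_weight_vertex_weight)
sublocale C: ice_weight "conj_weight q s v" using sv by (rule ice_weight_conj_weight)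

definition rows_up :: "nat \<Rightarrow> (nat \<Rightarrow> nat) \<Rightarrow> (nat \<Rightarrow> nat) \<Rightarrow> nat \<Rightarrow> nat \<Rightarrow> nat \<Rightarrow> complex" where
  "rows_up B a b n j i = (\<Sum>k\<in>bounded_occs B n.
     row_weight (vertex_weight q s u) 1 a k n j * row_weight (conj_weight q s v) 0 b k n i)"

definition rows_down :: "nat \<Rightarrow> (nat \<Rightarrow> nat) \<Rightarrow> (nat \<Rightarrow> nat) \<Rightarrow> nat \<Rightarrow> nat \<Rightarrow> nat \<Rightarrow> complex" where
  "rows_down B a b n j i = (\<Sum>k\<in>bounded_occs B n.
     row_weight (vertex_weight q s u) 1 k b n j * row_weight (conj_weight q s v) 0 k a n i)"

lemma rows_up_Suc:
  "rows_up B a b (Suc n) j i =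
     (\<Sum>p\<in>{0,1}\<times>{0,1}. rows_up B a b n (fst p) (snd p) * up B (a n) (b n) (fst p) (snd p) j i)"
proof -
  let ?p = "\<lambda>k x. row_weight (vertex_weight q s u) 1 a k n x"
  let ?r = "\<lambda>k x. row_weight (conj_weight q s v) 0 b k n x"
  have c: "?p (k(n := m)) x = ?p k x" "?r (k(n := m)) x = ?r k x" for k m x
    by (auto intro!: row_cong)
  have "rows_up B a b (Suc n) j i = (\<Sum>k\<in>bounded_occs B n. \<Sum>m\<le>B.
      (?p k 0 * vertex_weight q s u (a n) 0 m j + ?p k 1 * vertex_weight q s u (a n) 1 m j) *
      (?r k 0 * conj_weight q s v (b n) 0 m i + ?r k 1 * conj_weight q s v (b n) 1 m i))"
    unfolding rows_up_def sum_bounded_occs_Suc by (simp only: row_weight.simps c fun_upd_same)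
  also have "\<dots> = (\<Sum>k\<in>bounded_occs B n. \<Sum>p\<in>{0,1}\<times>{0,1}.
      (?p k (fst p) * ?r k (snd p)) * up B (a n) (b n) (fst p) (snd p) j i)"
    unfolding up_def sum.cartesian_product'
    by (rule sum.cong[OF refl]) (simp add: sum.distrib sum_distrib_left algebra_simps)
  also have "\<dots> = (\<Sum>p\<in>{0,1}\<times>{0,1}. \<Sum>k\<in>bounded_occs B n.
      (?p k (fst p) * ?r k (snd p)) * up B (a n) (b n) (fst p) (snd p) j i)"
    by (rule sum.swap)
  finally show ?thesis by (simp only: rows_up_def sum_distrib_right)
qed

lemma rows_down_Suc:
  "rows_down B a b (Suc n) j i =
     (\<Sum>p\<in>{0,1}\<times>{0,1}. rows_down B a b n (fst p) (snd p) * down B (a n) (b n) (fst p) (snd p) j i)"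
proof -
  let ?p = "\<lambda>k x. row_weight (vertex_weight q s u) 1 k b n x"
  let ?r = "\<lambda>k x. row_weight (conj_weight q s v) 0 k a n x"
  have c: "?p (k(n := m)) x = ?p k x" "?r (k(n := m)) x = ?r k x" for k m x
    by (auto intro!: row_cong)
  have "rows_down B a b (Suc n) j i = (\<Sum>k\<in>bounded_occs B n. \<Sum>m\<le>B.
      (?p k 0 * vertex_weight q s u m 0 (b n) j + ?p k 1 * vertex_weight q s u m 1 (b n) j) *
      (?r k 0 * conj_weight q s v m 0 (a n) i + ?r k 1 * conj_weight q s v m 1 (a n) i))"
    unfolding rows_down_def sum_bounded_occs_Suc by (simp only: row_weight.simps c fun_upd_same)
  also have "\<dots> = (\<Sum>k\<in>bounded_occs B n. \<Sum>p\<in>{0,1}\<times>{0,1}.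
      (?p k (fst p) * ?r k (snd p)) * down B (a n) (b n) (fst p) (snd p) j i)"
    unfolding down_def sum.cartesian_product'
    by (rule sum.cong[OF refl]) (simp add: sum.distrib sum_distrib_left algebra_simps)
  also have "\<dots> = (\<Sum>p\<in>{0,1}\<times>{0,1}. \<Sum>k\<in>bounded_occs B n.
      (?p k (fst p) * ?r k (snd p)) * down B (a n) (b n) (fst p) (snd p) j i)"
    by (rule sum.swap)
  finally show ?thesis by (simp only: rows_down_def sum_distrib_right)
qed

text \<open>The base case is the eigenvector property of the state \<open>(1, 0)\<close>; the
  intertwining relation carries it through the columns.\<close>

lemma rows_intertwine:
  assumes "\<And>x. a x < B" "\<And>x. b x < B" and "t \<in> {0,1}\<times>{0,1}"
  shows "(\<Sum>p\<in>{0,1}\<times>{0,1}. rows_up B a b n (fst p) (snd p) * cross (fst p) (snd p) (fst t) (snd t)) =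
    (1 - q * u * v) * rows_down B a b n (fst t) (snd t)"
  using assms(3)
proof (induction n arbitrary: t)
  case 0
  have "bounded_occs B 0 = {\<lambda>_. 0}" by (auto simp: bounded_occs_def)
  then show ?case
    using 0 by (auto simp: rows_up_def rows_down_def cross_def sum.cartesian_product')
next
  case (Suc n)
  have *: "(\<Sum>x\<in>{0,1}\<times>{0,1}. up B (a n) (b n) (fst r) (snd r) (fst x) (snd x) *
        cross (fst x) (snd x) (fst t) (snd t)) =
      (\<Sum>x\<in>{0,1}\<times>{0,1}. cross (fst r) (snd r) (fst x) (snd x) *
        down B (a n) (b n) (fst x) (snd x) (fst t) (snd t))"
    if "r \<in> {0,1}\<times>{0,1}" "t \<in> {0,1}\<times>{0,1}" for r t
  proof -
    have "fst r \<in> {0,1}" "snd r \<in> {0,1}" "fst t \<in> {0,1}" "snd t \<in> {0,1}" using that by auto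
    from intertwine[OF assms(1)[of n] assms(2)[of n] this] show ?thesis
      unfolding sum.cartesian_product case_prod_unfold .
  qed
  show ?case
    unfolding rows_up_Suc rows_down_Suc
    by (rule matrix_intertwine_step[where T = "\<lambda>r x. up B (a n) (b n) (fst r) (snd r) (fst x) (snd x)"
          and Q = "\<lambda>x t. cross (fst x) (snd x) (fst t) (snd t)"
          and T' = "\<lambda>x t. down B (a n) (b n) (fst x) (snd x) (fst t) (snd t)"
          and A = "\<lambda>p. rows_up B a b n (fst p) (snd p)"
          and D = "\<lambda>p. rows_down B a b n (fst p) (snd p)", OF Suc.IH * Suc.prems])
qed

text \<open>\<open>cross\<close> preserves the difference of the two occupations, so only the states
  \<open>(0, 0)\<close> and \<open>(1, 1)\<close> lead to \<open>(0, 0)\<close>.\<close>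

lemma rows_intertwine_00:
  assumes "\<And>x. a x < B" "\<And>x. b x < B"
  shows "(1 - u * v) * rows_up B a b n 0 0 + (1 - q) * rows_up B a b n 1 1 =
    (1 - q * u * v) * rows_down B a b n 0 0"
  using rows_intertwine[where a = a and b = b and t = "(0, 0)" and n = n, OF assms]
  by (simp add: sum.cartesian_product' cross_def mult.commute)

text \<open>Over a column with nothing below, a path leaving to the right must have come from the
  left. So \<open>(1, 1)\<close> is reached only from itself, with an empty middle edge.\<close>

lemma rows_up_tail:
  assumes "\<forall>x\<ge>X. a x = 0 \<and> b x = 0"
  shows "rows_up B a b (X + m) 1 1 =
    ((u - s) / (1 - s * u) * ((v - s) / (1 - s * v))) ^ m * rows_up B a b X 1 1"
proof (induction m)
  case (Suc m)
  have "a (X + m) = 0" "b (X + m) = 0" using assms by auto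
  then have "rows_up B a b (Suc (X + m)) 1 1 =
      rows_up B a b (X + m) 1 1 * ((u - s) / (1 - s * u) * ((v - s) / (1 - s * v)))"
    unfolding rows_up_Suc
    by (simp add: sum.cartesian_product' up_def vertex_weight_simps conj_weight_simps sum_single)
  then show ?case using Suc.IH by simp
qed auto

lemma occ_below_bounded_occs: "L \<le> B \<Longrightarrow> occ_below L n \<subseteq> bounded_occs B n"
proof
  fix f assume "L \<le> B" "f \<in> occ_below L n"
  then have "f x \<le> B" for x using occ_below_le[of f L n x] by simp
  then show "f \<in> bounded_occs B n"
    using \<open>f \<in> occ_below L n\<close> by (simp add: bounded_occs_def occ_below_def)
qed

lemma rows_up_eq:
  assumes "a \<in> occ_below M n" "b \<in> occ_below (Suc M) n" "Suc M \<le> B"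
  shows "rows_up B a b n 0 0 = (\<Sum>k\<in>occ_below (Suc M) n.
    row_total (vertex_weight q s u) 1 a k * row_total (conj_weight q s v) 0 b k)"
proof -
  have "rows_up B a b n 0 0 = (\<Sum>k\<in>occ_below (Suc M) n.
      row_weight (vertex_weight q s u) 1 a k n 0 * row_weight (conj_weight q s v) 0 b k n 0)"
    unfolding rows_up_def
  proof (intro sum.mono_neutral_right ballI)
    fix k assume k: "k \<in> bounded_occs B n - occ_below (Suc M) n"
    then have "(\<Sum>x<n. k x) \<noteq> (\<Sum>x<n. b x)" using assms(2) by (auto simp: bounded_occs_def occ_below_def)
    then have "row_weight (conj_weight q s v) 0 b k n 0 = 0"
      using C.row_flux[of 0 b k n 0] by auto
    then show "row_weight (vertex_weight q s u) 1 a k n 0 * row_weight (conj_weight q s v) 0 b k n 0 = 0"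
      by simp
  qed (use assms finite_bounded_occs occ_below_bounded_occs in auto)
  also have "\<dots> = (\<Sum>k\<in>occ_below (Suc M) n.
      row_total (vertex_weight q s u) 1 a k * row_total (conj_weight q s v) 0 b k)"
    using assms
    by (intro sum.cong refl arg_cong2[where f = "(*)"] W.row_total_eq[symmetric] C.row_total_eq[symmetric])
      (auto simp: occ_below_def)
  finally show ?thesis .
qed

lemma rows_down_eq:
  assumes "a \<in> occ_below M n" "b \<in> occ_below (Suc M) n" "Suc M \<le> B"
  shows "rows_down B a b n 0 0 = (\<Sum>\<^sub>\<infinity>k\<in>occs M.
    row_total (vertex_weight q s u) 1 k b * row_total (conj_weight q s v) 0 k a)"
proof -
  have "rows_down B a b n 0 0 = (\<Sum>k\<in>occ_below M n.
      row_weight (vertex_weight q s u) 1 k b n 0 * row_weight (conj_weight q s v) 0 k a n 0)"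
    unfolding rows_down_def
  proof (intro sum.mono_neutral_right ballI)
    fix k assume k: "k \<in> bounded_occs B n - occ_below M n"
    then have "(\<Sum>x<n. k x) \<noteq> (\<Sum>x<n. a x)" using assms(1) by (auto simp: bounded_occs_def occ_below_def)
    then have "row_weight (conj_weight q s v) 0 k a n 0 = 0"
      using C.row_flux[of 0 k a n 0] by auto
    then show "row_weight (vertex_weight q s u) 1 k b n 0 * row_weight (conj_weight q s v) 0 k a n 0 = 0"
      by simp
  qed (use assms finite_bounded_occs occ_below_bounded_occs in auto)
  also have "\<dots> = (\<Sum>k\<in>occ_below M n.
      row_total (vertex_weight q s u) 1 k b * row_total (conj_weight q s v) 0 k a)"
    using assms
    by (intro sum.cong refl arg_cong2[where f = "(*)"] W.row_total_eq[symmetric] C.row_total_eq[symmetric])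
      (auto simp: occ_below_def)
  also have "\<dots> = (\<Sum>\<^sub>\<infinity>k\<in>occ_below M n.
      row_total (vertex_weight q s u) 1 k b * row_total (conj_weight q s v) 0 k a)"
    by (simp add: finite_occ_below)
  also have "\<dots> = (\<Sum>\<^sub>\<infinity>k\<in>occs M.
      row_total (vertex_weight q s u) 1 k b * row_total (conj_weight q s v) 0 k a)"
    using W.row_total_support[of 1 _ b M "Suc M" n] assms(2) occ_below_occs
    by (intro infsum_cong_neutral) auto
  finally show ?thesis .
qed

text \<open>\<open>(1 - s * u) * (1 - s * v) - (u - s) * (v - s) = (1 - s * s) * (1 - u *
  v)\<close>, so \<open>u * v = 1\<close> would make the product of the two ratios equal to
  one.\<close>

lemma one_minus_uv_nonzero:
  assumes "norm ((u - s) / (1 - s * u) * ((v - s) / (1 - s * v))) < 1"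
  shows "1 - u * v \<noteq> 0"
proof
  assume "1 - u * v = 0"
  then have "(1 - s * u) * (1 - s * v) = (u - s) * (v - s)" by algebra
  then have "(u - s) / (1 - s * u) * ((v - s) / (1 - s * v)) = 1"
    using su sv by (metis divide_self mult_eq_0_iff times_divide_times_eq)
  then show False using assms by simp
qed

text \<open>The term \<open>rows_up B a b n 1 1\<close> accounts for the paths that have not yet turned up in the
  first \<open>n\<close> columns; it decays geometrically, so the intertwining relation for finitely many
  columns becomes the identity for the infinite sum.\<close>

theorem single_row_skew_cauchy:
  assumes z: "norm ((u - s) / (1 - s * u) * ((v - s) / (1 - s * v))) < 1"
    and a: "a \<in> occs M" and b: "b \<in> occs (Suc M)"
    and summable: "(\<lambda>k. row_total (vertex_weight q s u) 1 a k * row_total (conj_weight q s v) 0 b k)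
      summable_on occs (Suc M)"
  shows "(\<Sum>\<^sub>\<infinity>k\<in>occs (Suc M). row_total (vertex_weight q s u) 1 a k * row_total (conj_weight q s v) 0 b k)
    = (1 - q * u * v) / (1 - u * v) *
      (\<Sum>\<^sub>\<infinity>k\<in>occs M. row_total (vertex_weight q s u) 1 k b * row_total (conj_weight q s v) 0 k a)"
    (is "?l = _ * ?r")
proof -
  obtain X' where X': "a \<in> occ_below M X'" using occs_belowE[OF a] .
  obtain X where X: "b \<in> occ_below (Suc M) X" "X \<ge> X'" using occs_belowE[OF b] .
  \<comment> \<open>\<open>b\<close> may put \<open>M + 1\<close> paths into one column, and the
    intertwining relation needs a strict bound.\<close>
  define B where "B = Suc (Suc M)"
  have lt: "a x < B" "b x < B" for x using occs_le[OF a, of x] occs_le[OF b, of x] by (auto simp: B_def)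
  let ?z = "(u - s) / (1 - s * u) * ((v - s) / (1 - s * v))"
  have eq: "(1 - u * v) * (\<Sum>k\<in>occ_below (Suc M) (X + m).
      row_total (vertex_weight q s u) 1 a k * row_total (conj_weight q s v) 0 b k)
      = (1 - q * u * v) * ?r - (1 - q) * (?z ^ m * rows_up B a b X 1 1)" for m
  proof -
    have "a \<in> occ_below M (X + m)" "b \<in> occ_below (Suc M) (X + m)"
      using X X' occ_below_mono[of X "X + m"] occ_below_mono[of X' "X + m"] by auto
    from rows_up_eq[OF this, of B] rows_down_eq[OF this, of B] rows_intertwine_00[of a B b "X + m"] lt
    have "(1 - u * v) * (\<Sum>k\<in>occ_below (Suc M) (X + m).
        row_total (vertex_weight q s u) 1 a k * row_total (conj_weight q s v) 0 b k)
        + (1 - q) * rows_up B a b (X + m) 1 1 = (1 - q * u * v) * ?r" by (simp add: B_def)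
    moreover have "\<forall>x\<ge>X. a x = 0 \<and> b x = 0" using X X' by (auto simp: occ_below_def)
    ultimately show ?thesis using rows_up_tail[of X a b B m] by (simp add: algebra_simps)
  qed
  have "(\<lambda>m. (1 - q * u * v) * ?r - (1 - q) * (?z ^ m * rows_up B a b X 1 1))
      \<longlonglongrightarrow> (1 - q * u * v) * ?r - (1 - q) * (0 * rows_up B a b X 1 1)"
    by (intro tendsto_intros LIMSEQ_power_zero z)
  then have "(\<lambda>m. (1 - u * v) * (\<Sum>k\<in>occ_below (Suc M) (X + m).
      row_total (vertex_weight q s u) 1 a k * row_total (conj_weight q s v) 0 b k))
      \<longlonglongrightarrow> (1 - q * u * v) * ?r" by (simp only: eq mult_zero_left mult_zero_right diff_zero)
  moreover have "(\<lambda>m. (1 - u * v) * (\<Sum>k\<in>occ_below (Suc M) (X + m).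
      row_total (vertex_weight q s u) 1 a k * row_total (conj_weight q s v) 0 b k))
      \<longlonglongrightarrow> (1 - u * v) * ?l"
    using LIMSEQ_ignore_initial_segment[OF tendsto_sum_occ_below[OF summable], of X]
    by (intro tendsto_mult_left) (simp add: add.commute)
  ultimately have "(1 - u * v) * ?l = (1 - q * u * v) * ?r" by (rule LIMSEQ_unique[rotated])
  then show ?thesis using one_minus_uv_nonzero[OF z] by (simp add: field_simps)
qed

end

subsection \<open>Iterated rows\<close>

text \<open>\<open>e = 1\<close>, \<open>L = 0\<close> will give F and \<open>e = 0\<close> will
  give G; every row adds \<open>e\<close> paths, hence the index set
  \<open>occs (L + e * k)\<close>.\<close>

primrec iterate_rows ::
  "(nat \<Rightarrow> nat \<Rightarrow> nat \<Rightarrow> nat \<Rightarrow> nat \<Rightarrow> complex) \<Rightarrow> nat \<Rightarrow> nat \<Rightarrow> (nat \<Rightarrow> nat) \<Rightarrow> nat \<Rightarrow> (nat \<Rightarrow> nat) \<Rightarrow> complex"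
  where
    "iterate_rows w e L \<mu> 0 = (\<lambda>f. of_bool (f = \<mu>))"
  | "iterate_rows w e L \<mu> (Suc k) =
       (\<lambda>f. \<Sum>\<^sub>\<infinity>t\<in>occs (L + e * k). iterate_rows w e L \<mu> k t * row_total (w (Suc k)) e t f)"

lemma summable_on_dominated:
  fixes f :: "'a \<Rightarrow> complex" and g :: "'a \<Rightarrow> real"
  assumes "g summable_on A" "\<And>x. x \<in> A \<Longrightarrow> norm (f x) \<le> g x"
  shows "f summable_on A"
  using Infinite_Sum.abs_summable_on_comparison_test'[OF assms] by (rule Infinite_Sum.abs_summable_summable)

lemma infsum_swap_dominated:
  fixes f :: "'a \<Rightarrow> 'b \<Rightarrow> complex" and g :: "'a \<Rightarrow> real" and h :: "'b \<Rightarrow> real"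
  assumes "g summable_on A" "h summable_on B"
    and "\<And>x. x \<in> A \<Longrightarrow> g x \<ge> 0" "\<And>y. y \<in> B \<Longrightarrow> h y \<ge> 0"
    and "\<And>x y. x \<in> A \<Longrightarrow> y \<in> B \<Longrightarrow> norm (f x y) \<le> g x * h y"
  shows "(\<Sum>\<^sub>\<infinity>x\<in>A. \<Sum>\<^sub>\<infinity>y\<in>B. f x y) = (\<Sum>\<^sub>\<infinity>y\<in>B. \<Sum>\<^sub>\<infinity>x\<in>A. f x y)"
proof (rule infsum_swap_banach, rule summable_on_dominated)
  show "(\<lambda>p. g (fst p) * h (snd p)) summable_on A \<times> B"
    using assms(1-4) by (rule summable_on_times_nonneg)
qed (use assms(5) in auto)

lemma (in ice_weight) row_total_bound_divide:
  assumes "\<alpha> > 0" "norm (w 0 1 0 1) \<le> \<alpha>" "e \<le> 1"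
  obtains C where "C > 0"
    "\<And>a k. a \<in> occs L \<Longrightarrow> k \<in> occs L' \<Longrightarrow> norm (row_total w e a k) \<le> C * (\<alpha> ^ wt k / \<alpha> ^ wt a)"
proof -
  obtain C where "C > 0" "\<forall>a\<in>occs L. \<forall>k\<in>occs L'. norm (row_total w e a k) * \<alpha> ^ wt a \<le> C * \<alpha> ^ wt k"
    using row_total_bound[OF assms] by blast
  then show thesis using assms(1) by (intro that[of C]) (auto simp: field_simps)
qed

text \<open>A row turns the bound \<open>\<alpha>' ^ wt t\<close> into
  \<open>\<alpha> ^ wt f\<close> times the sum of \<open>(\<alpha>' / \<alpha>) ^ wt t\<close>; a
  strict increase of the rate makes this sum converge. So the claim is made for every
  \<open>\<alpha> > a\<close>, and the earlier rows get the midpoint of \<open>a\<close> and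
  \<open>\<alpha>\<close>.\<close>

lemma iterate_rows_bound:
  assumes "\<And>i. i \<in> {1..k} \<Longrightarrow> ice_weight (w i)" "\<And>i. i \<in> {1..k} \<Longrightarrow> norm (w i 0 1 0 1) \<le> a"
    and "0 \<le> a" "a < \<alpha>" "e \<le> 1"
  shows "\<exists>C\<ge>0. \<forall>f\<in>occs (L + e * k). norm (iterate_rows w e L \<mu> k f) \<le> C * \<alpha> ^ wt f"
  using assms(1,2,4)
proof (induction k arbitrary: \<alpha>)
  case 0
  then show ?case using assms(3) by (intro exI[of _ "1 / \<alpha> ^ wt \<mu>"]) (auto simp: of_bool_def)
next
  case (Suc k)
  define \<alpha>' where "\<alpha>' = (a + \<alpha>) / 2"
  have \<alpha>': "a < \<alpha>'" "\<alpha>' < \<alpha>" "\<alpha>' > 0" "\<alpha> > 0" using Suc.prems(3) assms(3) by (auto simp: \<alpha>'_def)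
  obtain C where C: "C \<ge> 0" "\<And>f. f \<in> occs (L + e * k) \<Longrightarrow> norm (iterate_rows w e L \<mu> k f) \<le> C * \<alpha>' ^ wt f"
    using Suc.IH[of \<alpha>'] Suc.prems \<alpha>' by auto
  interpret ice_weight "w (Suc k)" using Suc.prems(1) by simp
  obtain D where D: "D > 0" "\<And>t f. t \<in> occs (L + e * k) \<Longrightarrow> f \<in> occs (L + e * Suc k) \<Longrightarrow>
      norm (row_total (w (Suc k)) e t f) \<le> D * (\<alpha> ^ wt f / \<alpha> ^ wt t)"
    using row_total_bound_divide[of \<alpha> e "L + e * k" "L + e * Suc k"] Suc.prems(2)[of "Suc k"]
      Suc.prems(3) \<alpha>' assms(5) by auto
  have sm: "(\<lambda>t. (\<alpha>' / \<alpha>) ^ wt t) summable_on occs (L + e * k)"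
    using \<alpha>' by (intro summable_on_wt) auto
  let ?S = "\<Sum>\<^sub>\<infinity>t\<in>occs (L + e * k). (\<alpha>' / \<alpha>) ^ wt t"
  have "norm (iterate_rows w e L \<mu> (Suc k) f) \<le> (C * D * ?S) * \<alpha> ^ wt f"
    if f: "f \<in> occs (L + e * Suc k)" for f
  proof -
    have le: "norm (iterate_rows w e L \<mu> k t * row_total (w (Suc k)) e t f)
        \<le> (C * D * \<alpha> ^ wt f) * (\<alpha>' / \<alpha>) ^ wt t" if t: "t \<in> occs (L + e * k)" for t
    proof -
      have "norm (iterate_rows w e L \<mu> k t * row_total (w (Suc k)) e t f)
          \<le> (C * \<alpha>' ^ wt t) * (D * (\<alpha> ^ wt f / \<alpha> ^ wt t))"
        unfolding norm_mult using C D t f \<alpha>' by (intro mult_mono) auto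
      then show ?thesis by (simp add: power_divide mult_ac)
    qed
    have S: "((\<lambda>t. (C * D * \<alpha> ^ wt f) * (\<alpha>' / \<alpha>) ^ wt t) has_sum (C * D * \<alpha> ^ wt f) * ?S) (occs (L + e * k))"
      by (intro has_sum_cmult_right has_sum_infsum sm)
    then have "(\<lambda>t. iterate_rows w e L \<mu> k t * row_total (w (Suc k)) e t f) summable_on occs (L + e * k)"
      by (rule summable_on_dominated[OF has_sum_imp_summable le])
    then have "norm (\<Sum>\<^sub>\<infinity>t\<in>occs (L + e * k). iterate_rows w e L \<mu> k t * row_total (w (Suc k)) e t f)
        \<le> (C * D * \<alpha> ^ wt f) * ?S"
      by (intro norm_infsum_le[OF has_sum_infsum S le])
    then show ?thesis by (simp add: mult_ac)
  qed
  moreover have "C * D * ?S \<ge> 0" using C D \<alpha>' by (auto intro!: mult_nonneg_nonneg infsum_nonneg)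
  ultimately show ?case by blast
qed

lemma exists_common_factors:
  fixes x y :: "nat \<Rightarrow> real"
  assumes "finite I" "finite J" "\<And>i j. i \<in> I \<Longrightarrow> j \<in> J \<Longrightarrow> x i * y j < 1"
    and "\<And>i. i \<in> I \<Longrightarrow> x i \<ge> 0" "\<And>j. j \<in> J \<Longrightarrow> y j \<ge> 0"
  obtains a b \<alpha> \<beta> where "0 \<le> a" "a < \<alpha>" "0 \<le> b" "b < \<beta>" "\<alpha> * \<beta> < 1"
    "\<And>i. i \<in> I \<Longrightarrow> x i \<le> a" "\<And>j. j \<in> J \<Longrightarrow> y j \<le> b"
proof -
  \<comment> \<open>Inserting \<open>0\<close> covers an empty index set and keeps each maximum
    either zero or attained, so \<open>a * b < 1\<close> reduces to a single pair.\<close>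
  define a where "a = Max (insert 0 (x ` I))"
  define b where "b = Max (insert 0 (y ` J))"
  have a: "a \<in> insert 0 (x ` I)" "0 \<le> a" "\<And>i. i \<in> I \<Longrightarrow> x i \<le> a"
    unfolding a_def using assms(1) by (rule Max_in[OF finite.insertI[OF finite_imageI]] | simp)+
  have b: "b \<in> insert 0 (y ` J)" "0 \<le> b" "\<And>j. j \<in> J \<Longrightarrow> y j \<le> b"
    unfolding b_def using assms(2) by (rule Max_in[OF finite.insertI[OF finite_imageI]] | simp)+
  have "a * b < 1" using a(1) b(1) assms(3) by auto
  then obtain \<alpha> \<beta> where "\<alpha> > a" "\<beta> > b" "\<alpha> * \<beta> < 1"
    using exists_larger_factors a(2) b(2) by blast
  then show thesis using that a b by blast
qed

lemma occs_0: "occs 0 = {\<lambda>_. 0}"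
proof
  show "occs 0 \<subseteq> {\<lambda>_. 0}" using occs_le by fastforce
  have "(\<lambda>_. 0) \<in> occ_below 0 0" by (simp add: occ_below_def)
  then show "{\<lambda>_. 0} \<subseteq> occs 0" using occ_below_occs by blast
qed

section \<open>F as iterated rows, and its eigenfunction property\<close>

abbreviation F_rows :: "complex \<Rightarrow> complex \<Rightarrow> (nat \<Rightarrow> complex) \<Rightarrow> nat \<Rightarrow> (nat \<Rightarrow> nat) \<Rightarrow> complex" where
  "F_rows q s u \<equiv> iterate_rows (\<lambda>i. vertex_weight q s (u i)) 1 0 (\<lambda>_. 0)"

lemma F_rows_Suc:
  "F_rows q s u (Suc M) f =
     (\<Sum>\<^sub>\<infinity>t\<in>occs M. F_rows q s u M t * row_total (vertex_weight q s (u (Suc M))) 1 t f)"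
  by simp

lemma norm_vertex_weight_0101: "norm (vertex_weight q s u 0 1 0 1) = norm ((u - s) / (1 - s * u))"
  by (simp add: vertex_weight_def)

lemma norm_conj_weight_0101: "norm (conj_weight q s u 0 1 0 1) = norm ((u - s) / (1 - s * u))"
  by (simp add: conj_weight_def)

lemma F_rows_bound:
  assumes "\<And>i. i \<in> {1..M} \<Longrightarrow> 1 - s * u i \<noteq> 0"
    and "\<And>i. i \<in> {1..M} \<Longrightarrow> norm ((u i - s) / (1 - s * u i)) \<le> a" "0 \<le> a" "a < \<alpha>"
  obtains C where "C \<ge> 0" "\<And>f. f \<in> occs M \<Longrightarrow> norm (F_rows q s u M f) \<le> C * \<alpha> ^ wt f"
proof -
  have "\<exists>C\<ge>0. \<forall>f\<in>occs (0 + 1 * M). norm (F_rows q s u M f) \<le> C * \<alpha> ^ wt f"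
    by (rule iterate_rows_bound[where a = a])
      (use assms norm_vertex_weight_0101 ice_weight_vertex_weight in auto)
  then show thesis using that by auto
qed

text \<open>\<open>F\<close> is an eigenfunction of the row operator of \<open>G\<^sup>c\<close>: the row carrying \<open>v\<close> is moved
  through the rows carrying \<open>u M, \<dots>, u 1\<close> one at a time.\<close>

theorem F_rows_eigenfunction:
  assumes "\<And>i. i \<in> {1..M} \<Longrightarrow> 1 - s * u i \<noteq> 0" "1 - s * v \<noteq> 0"
    and "\<And>i. i \<in> {1..M} \<Longrightarrow> norm ((u i - s) / (1 - s * u i) * ((v - s) / (1 - s * v))) < 1"
    and "\<rho> \<in> occs M"
  shows "(\<Sum>\<^sub>\<infinity>k\<in>occs M. F_rows q s u M k * row_total (conj_weight q s v) 0 \<rho> k) =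
    (\<Prod>i\<in>{1..M}. (1 - q * u i * v) / (1 - u i * v)) * F_rows q s u M \<rho>"
  using assms
proof (induction M arbitrary: \<rho>)
  case 0
  interpret ice_weight "conj_weight q s v" using assms(2) by (rule ice_weight_conj_weight)
  have "row_total (conj_weight q s v) 0 (\<lambda>_. 0) (\<lambda>_. 0) = 1"
    by (subst row_total_eq[where n = 0]) auto
  then show ?case using 0 by (simp add: occs_0)
next
  case (Suc M)
  let ?w = "vertex_weight q s (u (Suc M))" and ?c = "conj_weight q s v"
  interpret two_weights q s "u (Suc M)" v using Suc.prems(1,2) by unfold_locales auto
  have contr: "norm ((u i - s) / (1 - s * u i)) * norm ((v - s) / (1 - s * v)) < 1" if "i \<in> {1..Suc M}" for i
    using Suc.prems(3)[OF that] by (simp only: norm_mult)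
  \<comment> \<open>The single G-row counts as a family indexed by \<open>{0}\<close>.\<close>
  obtain a b \<alpha> \<beta> where ab: "0 \<le> a" "a < \<alpha>" "0 \<le> b" "b < \<beta>" "\<alpha> * \<beta> < 1"
    "\<And>i. i \<in> {1..Suc M} \<Longrightarrow> norm ((u i - s) / (1 - s * u i)) \<le> a"
    and ab': "\<And>j. j \<in> {0::nat} \<Longrightarrow> norm ((v - s) / (1 - s * v)) \<le> b"
    by (rule exists_common_factors[of "{1..Suc M}" "{0::nat}" "\<lambda>i. norm ((u i - s) / (1 - s * u i))"
        "\<lambda>_. norm ((v - s) / (1 - s * v))"]) (use contr in \<open>simp_all del: norm_divide\<close>)
  have "norm ((v - s) / (1 - s * v)) \<le> b" using ab'[of 0] by simp
  note ab = ab this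
  \<comment> \<open>The first \<open>M\<close> rows get the smaller rate \<open>\<alpha>'\<close>,
    the last F-row gets \<open>\<alpha>\<close>; the quotient provides the decay in the occupation
    \<open>t\<close> between them.\<close>
  define \<alpha>' where "\<alpha>' = (a + \<alpha>) / 2"
  have pos: "a < \<alpha>'" "\<alpha>' < \<alpha>" "\<alpha>' > 0" "\<alpha> > 0" "\<beta> > 0" using ab by (auto simp: \<alpha>'_def)
  have "\<alpha>' * \<beta> \<le> \<alpha> * \<beta>" using pos by (intro mult_right_mono) auto
  then have \<alpha>'\<beta>: "\<alpha>' * \<beta> < 1" using ab(5) by (rule le_less_trans)
  have nu: "norm (?w 0 1 0 1) \<le> \<alpha>" and nv: "norm (?c 0 1 0 1) \<le> \<beta>"
    unfolding norm_vertex_weight_0101 norm_conj_weight_0101 using ab(2,4,7) ab(6)[of "Suc M"] by auto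
  obtain C1 where C1: "C1 \<ge> 0" "\<And>f. f \<in> occs M \<Longrightarrow> norm (F_rows q s u M f) \<le> C1 * \<alpha>' ^ wt f"
    by (rule F_rows_bound[of M s u a \<alpha>' q]) (use ab pos Suc.prems(1) in auto)
  obtain C2 where C2: "C2 > 0" "\<And>t k. t \<in> occs M \<Longrightarrow> k \<in> occs (Suc M) \<Longrightarrow>
      norm (row_total ?w 1 t k) \<le> C2 * (\<alpha> ^ wt k / \<alpha> ^ wt t)"
    by (rule W.row_total_bound_divide[where L = M and L' = "Suc M", OF pos(4) nu order_refl]) blast
  obtain C3 where C3: "C3 > 0" "\<And>t k. t \<in> occs (Suc M) \<Longrightarrow> k \<in> occs (Suc M) \<Longrightarrow>
      norm (row_total ?c 0 t k) \<le> C3 * (\<beta> ^ wt k / \<beta> ^ wt t)"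
    by (rule C.row_total_bound_divide[where L = "Suc M" and L' = "Suc M", OF pos(5) nv zero_le_one]) blast
  obtain C4 where C4: "C4 > 0" "\<And>t k. t \<in> occs M \<Longrightarrow> k \<in> occs M \<Longrightarrow>
      norm (row_total ?c 0 t k) \<le> C4 * (\<beta> ^ wt k / \<beta> ^ wt t)"
    by (rule C.row_total_bound_divide[where L = M and L' = M, OF pos(5) nv zero_le_one]) blast
  obtain X where X: "\<rho> \<in> occ_below (Suc M) X" using occs_belowE[OF Suc.prems(4)] .
  let ?z = "(1 - q * u (Suc M) * v) / (1 - u (Suc M) * v)"
  let ?P = "\<Prod>i\<in>{1..M}. (1 - q * u i * v) / (1 - u i * v)"
  let ?f = "F_rows q s u M"

  have "(\<Sum>\<^sub>\<infinity>k\<in>occs (Suc M). F_rows q s u (Suc M) k * row_total ?c 0 \<rho> k)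
      = (\<Sum>\<^sub>\<infinity>k\<in>occs (Suc M). \<Sum>\<^sub>\<infinity>t\<in>occs M. ?f t * row_total ?w 1 t k * row_total ?c 0 \<rho> k)"
    unfolding F_rows_Suc by (simp only: infsum_cmult_left')
  also have "\<dots> = (\<Sum>\<^sub>\<infinity>t\<in>occs M. \<Sum>\<^sub>\<infinity>k\<in>occs (Suc M). ?f t * row_total ?w 1 t k * row_total ?c 0 \<rho> k)"
  proof (rule infsum_swap_dominated)
    show "(\<lambda>k. C1 * C2 * C3 / \<beta> ^ wt \<rho> * (\<alpha> * \<beta>) ^ wt k) summable_on occs (Suc M)"
      using ab pos by (intro summable_on_cmult_right summable_on_wt) auto
    show "(\<lambda>t. (\<alpha>' / \<alpha>) ^ wt t) summable_on occs M"
      using pos by (intro summable_on_wt) auto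
    fix k t assume kt: "k \<in> occs (Suc M)" "t \<in> occs M"
    have "norm (?f t * row_total ?w 1 t k * row_total ?c 0 \<rho> k)
        \<le> (C1 * \<alpha>' ^ wt t) * (C2 * (\<alpha> ^ wt k / \<alpha> ^ wt t)) * (C3 * (\<beta> ^ wt k / \<beta> ^ wt \<rho>))"
      unfolding norm_mult using C1 C2 C3 kt pos Suc.prems(4) by (intro mult_mono mult_nonneg_nonneg) auto
    also have "\<dots> = C1 * C2 * C3 / \<beta> ^ wt \<rho> * (\<alpha> * \<beta>) ^ wt k * (\<alpha>' / \<alpha>) ^ wt t"
      by (simp add: power_divide power_mult_distrib mult_ac)
    finally show "norm (?f t * row_total ?w 1 t k * row_total ?c 0 \<rho> k)
        \<le> C1 * C2 * C3 / \<beta> ^ wt \<rho> * (\<alpha> * \<beta>) ^ wt k * (\<alpha>' / \<alpha>) ^ wt t" .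
  qed (use C1 C2 C3 pos in auto)
  also have "\<dots> = (\<Sum>\<^sub>\<infinity>t\<in>occs M. ?f t * (\<Sum>\<^sub>\<infinity>k\<in>occs (Suc M). row_total ?w 1 t k * row_total ?c 0 \<rho> k))"
    by (simp only: infsum_cmult_right' mult.assoc)
  also have "\<dots> = (\<Sum>\<^sub>\<infinity>t\<in>occs M. ?f t * (?z * (\<Sum>\<^sub>\<infinity>r\<in>occs M. row_total ?w 1 r \<rho> * row_total ?c 0 r t)))"
  proof (intro infsum_cong arg_cong2[where f = "(*)"] refl single_row_skew_cauchy)
    fix t assume t: "t \<in> occs M"
    show "(\<lambda>k. row_total ?w 1 t k * row_total ?c 0 \<rho> k) summable_on occs (Suc M)"
    proof (rule summable_on_dominated)
      show "(\<lambda>k. C2 * C3 / (\<alpha> ^ wt t * \<beta> ^ wt \<rho>) * (\<alpha> * \<beta>) ^ wt k) summable_on occs (Suc M)"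
        using ab pos by (intro summable_on_cmult_right summable_on_wt) auto
      fix k assume k: "k \<in> occs (Suc M)"
      have "norm (row_total ?w 1 t k * row_total ?c 0 \<rho> k)
          \<le> (C2 * (\<alpha> ^ wt k / \<alpha> ^ wt t)) * (C3 * (\<beta> ^ wt k / \<beta> ^ wt \<rho>))"
        unfolding norm_mult using C2 C3 t k pos Suc.prems(4) by (intro mult_mono mult_nonneg_nonneg) auto
      then show "norm (row_total ?w 1 t k * row_total ?c 0 \<rho> k)
          \<le> C2 * C3 / (\<alpha> ^ wt t * \<beta> ^ wt \<rho>) * (\<alpha> * \<beta>) ^ wt k"
        by (simp add: power_mult_distrib mult_ac)
    qed
  qed (use Suc.prems in auto)
  also have "\<dots> = ?z * (\<Sum>\<^sub>\<infinity>t\<in>occs M. \<Sum>\<^sub>\<infinity>r\<in>occs M. row_total ?w 1 r \<rho> * (?f t * row_total ?c 0 r t))"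
    by (simp only: infsum_cmult_right'[symmetric] mult_ac)
  also have "(\<Sum>\<^sub>\<infinity>t\<in>occs M. \<Sum>\<^sub>\<infinity>r\<in>occs M. row_total ?w 1 r \<rho> * (?f t * row_total ?c 0 r t))
      = (\<Sum>\<^sub>\<infinity>r\<in>occs M. \<Sum>\<^sub>\<infinity>t\<in>occs M. row_total ?w 1 r \<rho> * (?f t * row_total ?c 0 r t))"
  proof (rule infsum_swap_dominated)
    show "(\<lambda>t. C1 * C4 * (\<alpha>' * \<beta>) ^ wt t) summable_on occs M"
      using \<alpha>'\<beta> pos by (intro summable_on_cmult_right summable_on_wt) auto
    \<comment> \<open>In \<open>r\<close> the bound contains \<open>1 / \<beta> ^ wt r\<close>,
      which may grow; summability holds because only the finitely many \<open>r\<close> confined by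
      \<open>\<rho>\<close> contribute.\<close>
    have "{r \<in> occs M. norm (row_total ?w 1 r \<rho>) / \<beta> ^ wt r \<noteq> 0} \<subseteq> occ_below M X"
      using W.row_total_support[of 1 _ \<rho> M "Suc M" X] X by auto
    then show "(\<lambda>r. norm (row_total ?w 1 r \<rho>) / \<beta> ^ wt r) summable_on occs M"
      using finite_occ_below finite_subset by (blast intro: finite_nonzero_values_imp_summable_on)
    fix t r assume tr: "t \<in> occs M" "r \<in> occs M"
    have "norm (row_total ?w 1 r \<rho> * (?f t * row_total ?c 0 r t))
        \<le> norm (row_total ?w 1 r \<rho>) * ((C1 * \<alpha>' ^ wt t) * (C4 * (\<beta> ^ wt t / \<beta> ^ wt r)))"
      unfolding norm_mult using C1 C4 tr pos by (intro mult_mono mult_nonneg_nonneg) auto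
    also have "\<dots> = C1 * C4 * (\<alpha>' * \<beta>) ^ wt t * (norm (row_total ?w 1 r \<rho>) / \<beta> ^ wt r)"
      by (simp add: power_mult_distrib mult_ac)
    finally show "norm (row_total ?w 1 r \<rho> * (?f t * row_total ?c 0 r t))
        \<le> C1 * C4 * (\<alpha>' * \<beta>) ^ wt t * (norm (row_total ?w 1 r \<rho>) / \<beta> ^ wt r)" .
  qed (use C1 C4 pos in auto)
  also have "\<dots> = (\<Sum>\<^sub>\<infinity>r\<in>occs M. row_total ?w 1 r \<rho> * (?P * ?f r))"
    unfolding infsum_cmult_right' using Suc.IH Suc.prems by (intro infsum_cong) auto
  also have "\<dots> = ?P * F_rows q s u (Suc M) \<rho>"
    unfolding F_rows_Suc infsum_cmult_right'[symmetric] by (simp only: mult_ac)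
  finally show ?case by (simp add: mult_ac)
qed

text \<open>The occupation of the signature with \<open>M\<close> entries \<open>0\<close>.\<close>

definition pile :: "nat \<Rightarrow> nat \<Rightarrow> nat" where
  "pile M x = (if x = 0 then M else 0)"

lemma pile_occ_below: "n > 0 \<Longrightarrow> pile M \<in> occ_below M n"
  by (auto simp: occ_below_def pile_def)

lemma pile_occs: "pile M \<in> occs M"
  by (rule occ_below_occs[OF pile_occ_below[of 1]]) simp

lemma occ_below_1: "occ_below M 1 = {pile M}"
  using pile_occ_below[of 1 M] by (auto simp: occ_below_def pile_def fun_eq_iff)

lemma pile_0: "pile 0 = (\<lambda>_. 0)"
  by (auto simp: pile_def)

text \<open>All paths must turn up in column \<open>0\<close>, so below \<open>pile (Suc M)\<close>
  only \<open>pile M\<close> occurs. Each row thus contributes the weight of a single vertex, one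
  factor of \<open>qpoch q q\<close> over \<open>1 - s * u (Suc M)\<close>.\<close>

lemma F_rows_pile:
  assumes "\<And>i. i \<in> {1..M} \<Longrightarrow> 1 - s * u i \<noteq> 0"
  shows "(\<Prod>i\<in>{1..M}. 1 - s * u i) * F_rows q s u M (pile M) = qpoch q q M"
  using assms
proof (induction M)
  case 0
  then show ?case by (simp add: pile_0 qpoch_def)
next
  case (Suc M)
  let ?w = "vertex_weight q s (u (Suc M))"
  interpret ice_weight ?w using Suc.prems by (intro ice_weight_vertex_weight) auto
  have "F_rows q s u (Suc M) (pile (Suc M)) = (\<Sum>\<^sub>\<infinity>t\<in>occs M. F_rows q s u M t * row_total ?w 1 t (pile (Suc M)))"
    by (rule F_rows_Suc)
  also have "\<dots> = (\<Sum>\<^sub>\<infinity>t\<in>{pile M}. F_rows q s u M t * row_total ?w 1 t (pile (Suc M)))"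
  proof (rule infsum_cong_neutral)
    fix t assume "t \<in> occs M - {pile M}"
    then show "F_rows q s u M t * row_total ?w 1 t (pile (Suc M)) = 0"
      using row_total_support[of 1 t "pile (Suc M)" M "Suc M" 1] pile_occ_below[of 1] occ_below_1[of M]
      by auto
  qed (use pile_occs in auto)
  also have "\<dots> = F_rows q s u M (pile M) * row_total ?w 1 (pile M) (pile (Suc M))" by simp
  also have "row_total ?w 1 (pile M) (pile (Suc M)) = row_weight ?w 1 (pile M) (pile (Suc M)) 1 0"
    by (rule row_total_eq) (auto simp: pile_def)
  also have "\<dots> = (1 - q ^ Suc M) / (1 - s * u (Suc M))"
    by (simp add: pile_def vertex_weight_simps)
  finally have *: "F_rows q s u (Suc M) (pile (Suc M)) =
      F_rows q s u M (pile M) * ((1 - q ^ Suc M) / (1 - s * u (Suc M)))" .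
  have "(\<Prod>i\<in>{1..Suc M}. 1 - s * u i) * F_rows q s u (Suc M) (pile (Suc M)) =
      ((\<Prod>i\<in>{1..M}. 1 - s * u i) * F_rows q s u M (pile M)) * (1 - q ^ Suc M)"
    unfolding * using Suc.prems[of "Suc M"] by (simp del: iterate_rows.simps)
  also have "\<dots> = qpoch q q (Suc M)"
    using Suc by (simp add: qpoch_def)
  finally show ?case .
qed

section \<open>The pairing of F with G\<close>

abbreviation G_rows ::
    "complex \<Rightarrow> complex \<Rightarrow> (nat \<Rightarrow> complex) \<Rightarrow> nat \<Rightarrow> nat \<Rightarrow> (nat \<Rightarrow> nat) \<Rightarrow> complex" where
  "G_rows q s v M \<equiv> iterate_rows (\<lambda>j. conj_weight q s (v j)) 0 M (pile M)"

lemma G_rows_Suc: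
  "G_rows q s v M (Suc N) f =
     (\<Sum>\<^sub>\<infinity>t\<in>occs M. G_rows q s v M N t * row_total (conj_weight q s (v (Suc N))) 0 t f)"
  by simp

lemma G_rows_bound:
  assumes "\<And>i. i \<in> {1..N} \<Longrightarrow> 1 - s * v i \<noteq> 0"
    and "\<And>i. i \<in> {1..N} \<Longrightarrow> norm ((v i - s) / (1 - s * v i)) \<le> a" "0 \<le> a" "a < \<alpha>"
  obtains C where "C \<ge> 0" "\<And>f. f \<in> occs M \<Longrightarrow> norm (G_rows q s v M N f) \<le> C * \<alpha> ^ wt f"
proof -
  have "\<exists>C\<ge>0. \<forall>f\<in>occs (M + 0 * N). norm (G_rows q s v M N f) \<le> C * \<alpha> ^ wt f"
    by (rule iterate_rows_bound[where a = a])
      (use assms norm_conj_weight_0101 ice_weight_conj_weight in auto)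
  then show thesis using that by auto
qed

locale cauchy_variables =
  fixes q s :: complex and M N :: nat and u v :: "nat \<Rightarrow> complex"
  assumes su: "\<And>i. i \<in> {1..M} \<Longrightarrow> 1 - s * u i \<noteq> 0"
    and sv: "\<And>j. j \<in> {1..N} \<Longrightarrow> 1 - s * v j \<noteq> 0"
    and contracting: "\<And>i j. i \<in> {1..M} \<Longrightarrow> j \<in> {1..N} \<Longrightarrow>
      norm ((u i - s) / (1 - s * u i) * ((v j - s) / (1 - s * v j))) < 1"
begin

lemma factors:
  "\<exists>a b \<alpha> \<beta>. 0 \<le> a \<and> a < \<alpha> \<and> 0 \<le> b \<and> b < \<beta> \<and> \<alpha> * \<beta> < 1 \<and>
    (\<forall>i\<in>{1..M}. norm ((u i - s) / (1 - s * u i)) \<le> a) \<and>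
    (\<forall>j\<in>{1..N}. norm ((v j - s) / (1 - s * v j)) \<le> b)"
proof -
  have *: "norm ((u i - s) / (1 - s * u i)) * norm ((v j - s) / (1 - s * v j)) < 1"
    if "i \<in> {1..M}" "j \<in> {1..N}" for i j
    using contracting[OF that] by (simp only: norm_mult)
  show ?thesis
  proof (rule exists_common_factors[where I = "{1..M}" and J = "{1..N}"
        and x = "\<lambda>i. norm ((u i - s) / (1 - s * u i))" and y = "\<lambda>j. norm ((v j - s) / (1 - s * v j))",
        OF finite_atLeastAtMost finite_atLeastAtMost * norm_ge_zero norm_ge_zero])
    fix a b \<alpha> \<beta> :: real
    assume "0 \<le> a" "a < \<alpha>" "0 \<le> b" "b < \<beta>" "\<alpha> * \<beta> < 1"
      "\<And>i. i \<in> {1..M} \<Longrightarrow> norm ((u i - s) / (1 - s * u i)) \<le> a"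
      "\<And>j. j \<in> {1..N} \<Longrightarrow> norm ((v j - s) / (1 - s * v j)) \<le> b"
    then show ?thesis
      by (rule_tac exI[of _ a], rule_tac exI[of _ b], rule_tac exI[of _ \<alpha>], rule_tac exI[of _ \<beta>]) blast
  qed
qed

lemma F_G_summable: "(\<lambda>k. F_rows q s u M k * G_rows q s v M N k) summable_on occs M"
proof -
  obtain a b \<alpha> \<beta> where ab: "0 \<le> a" "a < \<alpha>" "0 \<le> b" "b < \<beta>" "\<alpha> * \<beta> < 1"
    "\<And>i. i \<in> {1..M} \<Longrightarrow> norm ((u i - s) / (1 - s * u i)) \<le> a"
    "\<And>j. j \<in> {1..N} \<Longrightarrow> norm ((v j - s) / (1 - s * v j)) \<le> b"
    using factors by metis
  obtain C1 where C1: "C1 \<ge> 0" "\<And>f. f \<in> occs M \<Longrightarrow> norm (F_rows q s u M f) \<le> C1 * \<alpha> ^ wt f"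
    by (rule F_rows_bound[of M s u a \<alpha> q]) (use ab su in auto)
  obtain C2 where C2: "C2 \<ge> 0" "\<And>f. f \<in> occs M \<Longrightarrow> norm (G_rows q s v M N f) \<le> C2 * \<beta> ^ wt f"
    by (rule G_rows_bound[of N s v b \<beta> M q]) (use ab sv in auto)
  show ?thesis
  proof (rule summable_on_dominated)
    show "(\<lambda>k. C1 * C2 * (\<alpha> * \<beta>) ^ wt k) summable_on occs M"
      using ab by (intro summable_on_cmult_right summable_on_wt) auto
    fix k assume k: "k \<in> occs M"
    have "norm (F_rows q s u M k * G_rows q s v M N k) \<le> (C1 * \<alpha> ^ wt k) * (C2 * \<beta> ^ wt k)"
      unfolding norm_mult using C1 C2 k ab by (intro mult_mono) auto
    then show "norm (F_rows q s u M k * G_rows q s v M N k) \<le> C1 * C2 * (\<alpha> * \<beta>) ^ wt k"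
      by (simp add: power_mult_distrib mult_ac)
  qed
qed

end

text \<open>Exchanging the sums peels off the last G-row. The eigenvalue it produces does not depend
  on the occupation \<open>t\<close> below it, so it factors out and the sum for \<open>N\<close>
  rows remains.\<close>

theorem F_G_rows_cauchy:
  assumes "cauchy_variables s M N u v"
  shows "(\<Sum>\<^sub>\<infinity>k\<in>occs M. F_rows q s u M k * G_rows q s v M N k) =
    (\<Prod>i\<in>{1..M}. \<Prod>j\<in>{1..N}. (1 - q * u i * v j) / (1 - u i * v j)) * F_rows q s u M (pile M)"
  using assms
proof (induction N)
  case 0
  have "(\<Sum>\<^sub>\<infinity>k\<in>occs M. F_rows q s u M k * G_rows q s v M 0 k) =
      (\<Sum>\<^sub>\<infinity>k\<in>{pile M}. F_rows q s u M k * G_rows q s v M 0 k)"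
    using pile_occs by (intro infsum_cong_neutral) auto
  then show ?case by simp
next
  case (Suc N)
  interpret S: cauchy_variables q s M "Suc N" u v by (rule Suc.prems)
  interpret cauchy_variables q s M N u v
    by unfold_locales (use S.su S.sv S.contracting in auto)
  let ?c = "conj_weight q s (v (Suc N))"
  have sv': "1 - s * v (Suc N) \<noteq> 0" using S.sv by auto
  interpret ice_weight ?c using sv' by (rule ice_weight_conj_weight)
  obtain a b \<alpha> \<beta> where ab: "0 \<le> a" "a < \<alpha>" "0 \<le> b" "b < \<beta>" "\<alpha> * \<beta> < 1"
    "\<And>i. i \<in> {1..M} \<Longrightarrow> norm ((u i - s) / (1 - s * u i)) \<le> a"
    "\<And>j. j \<in> {1..Suc N} \<Longrightarrow> norm ((v j - s) / (1 - s * v j)) \<le> b"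
    using S.factors by metis
  \<comment> \<open>The first \<open>N\<close> rows get a smaller rate than the last one, which
    gives decay in \<open>t\<close>.\<close>
  define \<beta>' where "\<beta>' = (b + \<beta>) / 2"
  have pos: "b < \<beta>'" "\<beta>' < \<beta>" "\<beta>' > 0" "\<beta> > 0" "\<alpha> > 0" using ab by (auto simp: \<beta>'_def)
  have nv: "norm (?c 0 1 0 1) \<le> \<beta>"
    unfolding norm_conj_weight_0101 using ab(4) ab(7)[of "Suc N"] by auto
  obtain C1 where C1: "C1 \<ge> 0" "\<And>f. f \<in> occs M \<Longrightarrow> norm (F_rows q s u M f) \<le> C1 * \<alpha> ^ wt f"
    by (rule F_rows_bound[of M s u a \<alpha> q]) (use ab su in auto)
  obtain C2 where C2: "C2 \<ge> 0" "\<And>f. f \<in> occs M \<Longrightarrow> norm (G_rows q s v M N f) \<le> C2 * \<beta>' ^ wt f"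
    by (rule G_rows_bound[of N s v b \<beta>' M q]) (use ab pos sv in auto)
  obtain C3 where C3: "C3 > 0" "\<And>t k. t \<in> occs M \<Longrightarrow> k \<in> occs M \<Longrightarrow>
      norm (row_total ?c 0 t k) \<le> C3 * (\<beta> ^ wt k / \<beta> ^ wt t)"
    by (rule row_total_bound_divide[where L = M and L' = M, OF pos(4) nv zero_le_one]) blast
  let ?P = "\<Prod>i\<in>{1..M}. (1 - q * u i * v (Suc N)) / (1 - u i * v (Suc N))"
  let ?f = "F_rows q s u M" and ?g = "G_rows q s v M N"
  have "(\<Sum>\<^sub>\<infinity>k\<in>occs M. ?f k * G_rows q s v M (Suc N) k) =
      (\<Sum>\<^sub>\<infinity>k\<in>occs M. \<Sum>\<^sub>\<infinity>t\<in>occs M. ?f k * (?g t * row_total ?c 0 t k))"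
    unfolding G_rows_Suc by (simp only: infsum_cmult_right')
  also have "\<dots> = (\<Sum>\<^sub>\<infinity>t\<in>occs M. \<Sum>\<^sub>\<infinity>k\<in>occs M. ?f k * (?g t * row_total ?c 0 t k))"
  proof (rule infsum_swap_dominated)
    show "(\<lambda>k. C1 * C2 * C3 * (\<alpha> * \<beta>) ^ wt k) summable_on occs M"
      using ab pos by (intro summable_on_cmult_right summable_on_wt) auto
    show "(\<lambda>t. (\<beta>' / \<beta>) ^ wt t) summable_on occs M"
      using pos by (intro summable_on_wt) auto
    fix k t assume kt: "k \<in> occs M" "t \<in> occs M"
    have "norm (?f k * (?g t * row_total ?c 0 t k))
        \<le> (C1 * \<alpha> ^ wt k) * ((C2 * \<beta>' ^ wt t) * (C3 * (\<beta> ^ wt k / \<beta> ^ wt t)))"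
      unfolding norm_mult using C1 C2 C3 kt pos by (intro mult_mono mult_nonneg_nonneg) auto
    then show "norm (?f k * (?g t * row_total ?c 0 t k))
        \<le> C1 * C2 * C3 * (\<alpha> * \<beta>) ^ wt k * (\<beta>' / \<beta>) ^ wt t"
      by (simp add: power_divide power_mult_distrib mult_ac)
  qed (use C1 C2 C3 pos in auto)
  also have "\<dots> = (\<Sum>\<^sub>\<infinity>t\<in>occs M. ?g t * (\<Sum>\<^sub>\<infinity>k\<in>occs M. ?f k * row_total ?c 0 t k))"
    by (simp only: infsum_cmult_right'[symmetric] mult_ac)
  also have "\<dots> = (\<Sum>\<^sub>\<infinity>t\<in>occs M. ?g t * (?P * ?f t))"
    using S.contracting[of _ "Suc N"] su sv'
    by (intro infsum_cong arg_cong2[where f = "(*)"] refl F_rows_eigenfunction) auto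
  also have "\<dots> = ?P * (\<Sum>\<^sub>\<infinity>t\<in>occs M. ?f t * ?g t)"
    by (simp only: infsum_cmult_right'[symmetric] mult_ac)
  also have "(\<Sum>\<^sub>\<infinity>t\<in>occs M. ?f t * ?g t) =
      (\<Prod>i\<in>{1..M}. \<Prod>j\<in>{1..N}. (1 - q * u i * v j) / (1 - u i * v j)) * ?f (pile M)"
    by (rule Suc.IH) unfold_locales
  also have "?P * ((\<Prod>i\<in>{1..M}. \<Prod>j\<in>{1..N}. (1 - q * u i * v j) / (1 - u i * v j)) * ?f (pile M)) =
      (\<Prod>i\<in>{1..M}. \<Prod>j\<in>{1..Suc N}. (1 - q * u i * v j) / (1 - u i * v j)) * ?f (pile M)"
    by (simp add: prod.distrib mult.commute
        del: times_divide_eq_left times_divide_eq_right times_divide_times_eq iterate_rows.simps)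
  finally show ?case .
qed

subsection \<open>Signatures and lattice paths\<close>

definition occ :: "int list \<Rightarrow> nat \<Rightarrow> nat" where
  "occ \<kappa> x = count_list \<kappa> (int x)"

text \<open>Turns inequalities between prefix sums of occupations into comparisons of entries of
  signatures.\<close>

lemma sum_occ:
  assumes "\<forall>x\<in>set \<kappa>. 0 \<le> x"
  shows "(\<Sum>x<t. occ \<kappa> x) = length (filter (\<lambda>z. z < int t) \<kappa>)"
  using assms
proof (induction \<kappa>)
  case (Cons a \<kappa>)
  have "(\<Sum>x<t. occ (a # \<kappa>) x) = (\<Sum>x<t. (if x = nat a then 1 else 0) + occ \<kappa> x)"
    using Cons.prems by (intro sum.cong) (auto simp: occ_def)
  also have "\<dots> = (if a < int t then 1 else 0) + (\<Sum>x<t. occ \<kappa> x)"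
    using Cons.prems by (auto simp: sum.distrib)
  finally show ?case using Cons by auto
qed (simp add: occ_def)

lemma occ_Sign_plus:
  assumes "\<kappa> \<in> Sign_plus L" "\<forall>x\<in>set \<kappa>. x < int n"
  shows "occ \<kappa> \<in> occ_below L n"
proof -
  have "filter (\<lambda>z. z < int n) \<kappa> = \<kappa>" using assms(2) by (auto simp: filter_id_conv)
  then have "(\<Sum>x<n. occ \<kappa> x) = L"
    using sum_occ[of \<kappa> n] assms(1) by (auto simp: Sign_plus_def Sign_def)
  moreover have "occ \<kappa> x = 0" if "x \<ge> n" for x
    using assms(2) that by (auto simp: occ_def count_list_0_iff)
  ultimately show ?thesis by (auto simp: occ_below_def)
qed

lemma Sign_plus_below: "\<exists>n>0. \<forall>x\<in>set \<kappa>. x < int n"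
proof -
  have "x < int (Suc (nat (Max (set \<kappa>))))" if "x \<in> set \<kappa>" for x
    using Max_ge[OF finite_set that] by linarith
  then show ?thesis by blast
qed

lemma occ_Sign_plus_occs: "\<kappa> \<in> Sign_plus L \<Longrightarrow> occ \<kappa> \<in> occs L"
  using Sign_plus_below[of \<kappa>] occ_Sign_plus occ_below_occs by blast

lemma mset_eq_if_occ_eq:
  assumes "\<kappa> \<in> Sign_plus L" "\<tau> \<in> Sign_plus L'" "occ \<kappa> = occ \<tau>"
  shows "mset \<kappa> = mset \<tau>"
proof (rule multiset_eqI)
  fix z
  show "count (mset \<kappa>) z = count (mset \<tau>) z"
  proof (cases "z \<ge> 0")
    case True
    then show ?thesis using fun_cong[OF assms(3), of "nat z"] by (simp add: occ_def count_mset)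
  next
    case False
    then have "z \<notin> set \<kappa>" "z \<notin> set \<tau>" using assms(1,2) by (auto simp: Sign_plus_def)
    then show ?thesis by (metis count_mset_0_iff)
  qed
qed

lemma occ_surj:
  assumes "f \<in> occ_below L n"
  obtains \<tau> where "\<tau> \<in> Sign_plus L" "\<forall>x\<in>set \<tau>. x < int n" "occ \<tau> = f"
proof -
  have "\<exists>xs. set xs \<subseteq> {0..<int m} \<and> (\<forall>x<m. count_list xs (int x) = f x) \<and> length xs = (\<Sum>x<m. f x)" for m
  proof (induction m)
    case (Suc m)
    then obtain xs where xs: "set xs \<subseteq> {0..<int m}" "\<forall>x<m. count_list xs (int x) = f x" "length xs = (\<Sum>x<m. f x)"
      by blast
    have "int m \<notin> set xs" using xs(1) by auto
    then have "count_list xs (int m) = 0" by (simp add: count_list_0_iff)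
    moreover have "count_list (replicate (f m) (int m)) z = (if z = int m then f m else 0)" for z
      by (simp add: count_mset[symmetric] del: count_mset)
    ultimately show ?case using xs
      by (intro exI[of _ "xs @ replicate (f m) (int m)"]) (auto simp: less_Suc_eq)
  qed simp
  then obtain xs where xs: "set xs \<subseteq> {0..<int n}" "\<forall>x<n. count_list xs (int x) = f x"
    "length xs = (\<Sum>x<n. f x)" by blast
  define \<tau> where "\<tau> = rev (sort xs)"
  have "sorted_wrt (\<ge>) \<tau>" unfolding \<tau>_def by (simp add: sorted_wrt_rev)
  moreover have "occ \<tau> x = f x" for x
  proof (cases "x < n")
    case False
    then have "int x \<notin> set xs" using xs(1) by auto
    then show ?thesis using False assms
      by (simp add: occ_def \<tau>_def occ_below_def count_list_0_iff)
  qed (use xs(2) in \<open>simp add: occ_def \<tau>_def count_mset[symmetric] del: count_mset\<close>)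
  moreover have "set \<tau> = set xs" "length \<tau> = L"
    using xs(3) assms by (auto simp: \<tau>_def occ_below_def)
  ultimately have "\<tau> \<in> Sign_plus L" "\<forall>x\<in>set \<tau>. x < int n" "occ \<tau> = f"
    using xs(1) by (auto simp: Sign_plus_def Sign_def)
  then show thesis by (rule that)
qed

lemma bij_betw_occ: "bij_betw occ (Sign_plus L) (occs L)"
proof (rule bij_betw_imageI)
  show "inj_on occ (Sign_plus L)"
  proof (rule inj_onI)
    fix \<kappa> \<tau> assume *: "\<kappa> \<in> Sign_plus L" "\<tau> \<in> Sign_plus L" "occ \<kappa> = occ \<tau>"
    have "sorted (rev \<kappa>)" "sorted (rev \<tau>)"
      using * by (auto simp: Sign_plus_def Sign_def sorted_wrt_rev)
    moreover have "mset (rev \<kappa>) = mset (rev \<tau>)" using mset_eq_if_occ_eq[OF *] by simp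
    ultimately have "rev \<kappa> = rev \<tau>" by (metis properties_for_sort)
    then show "\<kappa> = \<tau>" by simp
  qed
  show "occ ` Sign_plus L = occs L"
  proof
    show "occs L \<subseteq> occ ` Sign_plus L"
    proof
      fix f assume "f \<in> occs L"
      then obtain n where "f \<in> occ_below L n" by (rule occs_belowE)
      then show "f \<in> occ ` Sign_plus L" using occ_surj by blast
    qed
  qed (use occ_Sign_plus_occs in blast)
qed

section \<open>Single up-right paths\<close>

abbreviation unit_step :: "vertex \<Rightarrow> vertex \<Rightarrow> bool" where
  "unit_step \<equiv> \<lambda>a b. b = (fst a + 1, snd a) \<or> b = (fst a, snd a + 1)"

lemma path_edges_simps [simp]:
  "path_edges [] = {}" "path_edges [a] = {}"
  "path_edges (a # b # r) = insert (a, b) (path_edges (b # r))"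
  by (auto simp: path_edges_def)

lemma path_edges_vertices: "(a, b) \<in> path_edges p \<Longrightarrow> a \<in> set p \<and> b \<in> set p"
  by (induction p rule: induct_list012) auto

lemma path_edges_snoc: "q \<noteq> [] \<Longrightarrow> path_edges (q @ [v]) = insert (last q, v) (path_edges q)"
proof (induction q)
  case (Cons a q)
  then show ?case by (cases q) auto
qed simp

text \<open>Each step raises the sum of the coordinates, so a path visits no vertex twice; the
  degree relations below rest on this.\<close>

lemma unit_steps_level:
  assumes "successively unit_step (a # r)" "v \<in> set r"
  shows "fst a \<le> fst v \<and> snd a \<le> snd v \<and> fst a + snd a < fst v + snd v"
  using assms
proof (induction r arbitrary: a)
  case (Cons b r)
  then show ?case by (cases "v = b") force+
qed simp

lemma unit_steps_le_last:
  assumes "successively unit_step p" "v \<in> set p"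
  shows "fst v \<le> fst (last p) \<and> snd v \<le> snd (last p)"
  using assms
proof (induction p)
  case (Cons a p)
  show ?case
  proof (cases "p = []")
    case False
    then have "last p \<in> set p" by simp
    from unit_steps_level[OF Cons.prems(1) this] show ?thesis
      using Cons False by (auto simp: successively_Cons)
  qed (use Cons in auto)
qed simp

text \<open>A visited vertex is either the first one or entered through exactly one edge. The
  \<open>of_bool\<close> form is additive and can be summed over a collection.\<close>

lemma in_degree:
  assumes "successively unit_step p" "p \<noteq> []"
  shows "of_bool (((x - 1, y), (x, y)) \<in> path_edges p) + of_bool (((x, y - 1), (x, y)) \<in> path_edges p)
    + of_bool (hd p = (x, y)) = (of_bool ((x, y) \<in> set p) :: nat)"
  using assms
proof (induction p)
  case (Cons a p)
  show ?case
  proof (cases p)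
    case (Cons b r)
    have a: "a \<notin> set p" using unit_steps_level[OF Cons.prems(1), of a] by auto
    then have a': "(a, c) \<notin> path_edges p" for c using path_edges_vertices by blast
    have st: "b = (fst a + 1, snd a) \<or> b = (fst a, snd a + 1)" "successively unit_step p"
      using Cons.prems(1) Cons by auto
    note IH = Cons.IH[OF st(2)]
    show ?thesis
    proof (cases "b = (x, y)")
      case True
      then show ?thesis using IH a a' st Cons by (cases a) (auto split: if_splits)
    next
      case False
      then show ?thesis using IH a a' st Cons by (cases a) (auto split: if_splits)
    qed
  qed auto
qed simp

lemma out_degree:
  assumes "successively unit_step p" "p \<noteq> []"
  shows "of_bool (((x, y), (x + 1, y)) \<in> path_edges p) + of_bool (((x, y), (x, y + 1)) \<in> path_edges p)
    + of_bool (last p = (x, y)) = (of_bool ((x, y) \<in> set p) :: nat)"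
  using assms
proof (induction p)
  case (Cons a p)
  show ?case
  proof (cases p)
    case (Cons b r)
    have a: "a \<notin> set p" using unit_steps_level[OF Cons.prems(1), of a] by auto
    then have a': "(a, c) \<notin> path_edges p" for c using path_edges_vertices by blast
    have st: "b = (fst a + 1, snd a) \<or> b = (fst a, snd a + 1)" "successively unit_step p"
      using Cons.prems(1) Cons by auto
    note IH = Cons.IH[OF st(2)]
    have E: "path_edges (a # p) = insert (a, b) (path_edges p)" "last (a # p) = last p" "p \<noteq> []"
      using Cons by auto
    have l: "last p \<noteq> a" using a last_in_set[OF E(3)] by metis
    show ?thesis
    proof (cases "a = (x, y)")
      case True
      then show ?thesis using a a' st(1) l unfolding E by (auto simp: of_bool_def)
    next
      case False
      have "((x, y), c) \<in> path_edges (a # p) \<longleftrightarrow> ((x, y), c) \<in> path_edges p" for c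
        using False unfolding E by simp
      moreover have "(x, y) \<in> set (a # p) \<longleftrightarrow> (x, y) \<in> set p" using False by simp
      ultimately show ?thesis using IH[OF E(3)] E(2) by simp
    qed
  qed auto
qed simp

lemma size_filter_mset_sum: "size (filter_mset P C) = (\<Sum>p\<in>#C. of_bool (P p))"
  by (induction C) auto

lemma count_image_mset_size: "count (image_mset f C) e = size {#p \<in># C. f p = e#}"
  by (induction C) auto

lemma count_vertical_edges: "count (vertical_edges \<kappa> y) ((int x, y), (int x, y + 1)) = occ \<kappa> x"
  unfolding vertical_edges_def occ_def by (induction \<kappa>) auto

lemma in_vertical_edges: "E \<in># vertical_edges \<kappa> y \<longleftrightarrow> (\<exists>x\<in>set \<kappa>. E = ((x, y), (x, y + 1)))"
  by (auto simp: vertical_edges_def)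

lemma in_left_edges: "E \<in># left_edges k \<longleftrightarrow> (\<exists>j\<in>{1..k}. E = ((- 1, int j), (0, int j)))"
  by (auto simp: left_edges_def)

lemma left_edges_Suc: "left_edges (Suc k) = add_mset ((- 1, int k + 1), (0, int k + 1)) (left_edges k)"
  by (simp add: left_edges_def atLeastAtMostSuc_conv add.commute)

lemma count_left_edges: "count (left_edges k) ((- 1, int y), (0, int y)) = of_bool (1 \<le> y \<and> y \<le> k)"
  by (induction k) (auto simp: left_edges_Suc left_edges_def[of 0])

subsection \<open>Collections of paths\<close>

text \<open>Covers the paths of F and of G alike, so that the geometry is done once for a single
  path; \<open>n\<close> is an auxiliary bound that makes the region finite.\<close>

definition lattice_path :: "nat \<Rightarrow> nat \<Rightarrow> vertex list \<Rightarrow> bool" where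
  "lattice_path k n p \<longleftrightarrow> up_right_path p \<and>
     ((\<exists>x\<ge>0. first_edge p = ((x, 0), (x, 1))) \<or> (\<exists>j\<ge>1. first_edge p = ((- 1, j), (0, j)))) \<and>
     (\<exists>x. x < int n \<and> last_edge p = ((x, int k), (x, int k + 1)))"

context
  fixes k n :: nat and p :: "vertex list"
  assumes lp: "lattice_path k n p"
begin

lemma lattice_path_steps: "successively unit_step p" "p \<noteq> []" "2 \<le> length p"
  using lp by (auto simp: lattice_path_def up_right_path_def)

lemma lattice_path_split_first:
  obtains a b r where "p = a # b # r" "first_edge p = (a, b)"
    "\<And>v. v \<in> set (b # r) \<Longrightarrow> fst v \<ge> 0 \<and> snd v \<ge> 1" "fst a = - 1 \<or> snd a = 0"
proof -
  obtain a b r where p: "p = a # b # r" using lattice_path_steps(3)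
    by (metis One_nat_def Suc_1 Suc_le_length_iff)
  then have fe: "first_edge p = (a, b)" by (simp add: first_edge_def)
  have b: "fst b \<ge> 0 \<and> snd b \<ge> 1" "fst a = - 1 \<or> snd a = 0"
    using lp fe by (auto simp: lattice_path_def)
  have "fst v \<ge> 0 \<and> snd v \<ge> 1" if "v \<in> set (b # r)" for v
  proof (cases "v = b")
    case False
    then have "v \<in> set r" using that by simp
    then show ?thesis using unit_steps_level[of b r v] b lattice_path_steps(1) p by force
  qed (use b in simp)
  then show thesis using that p fe b(2) by blast
qed

lemma lattice_path_split_last:
  obtains r c d where "p = r @ [c, d]" "last_edge p = (c, d)" "snd d = int k + 1" "snd c = int k"
    "\<And>v. v \<in> set (r @ [c]) \<Longrightarrow> snd v \<le> int k" "\<And>v. v \<in> set p \<Longrightarrow> fst v < int n"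
proof -
  obtain q d where q: "p = q @ [d]" using lattice_path_steps(2) by (metis rev_exhaust)
  then have "q \<noteq> []" using lattice_path_steps(3) by auto
  then obtain r c where "q = r @ [c]" by (metis rev_exhaust)
  then have p: "p = r @ [c, d]" using q by simp
  then have le: "last_edge p = (c, d)" by (simp add: last_edge_def nth_append)
  have cd: "fst d < int n" "snd d = int k + 1" "snd c = int k"
    using lp le by (auto simp: lattice_path_def)
  have "successively unit_step (r @ [c])"
    using lattice_path_steps(1) p by (simp add: successively_append_iff)
  then have "snd v \<le> int k" if "v \<in> set (r @ [c])" for v
    using unit_steps_le_last[of "r @ [c]" v] that cd by simp
  moreover have "fst v < int n" if "v \<in> set p" for v
    using unit_steps_le_last[OF lattice_path_steps(1) that] p cd by simp
  ultimately show thesis using that p le cd by blast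
qed

lemma lattice_path_interior:
  "interior_vertices p \<subseteq> {(x, y). 0 \<le> x \<and> x < int n \<and> 1 \<le> y \<and> y \<le> int k}"
proof
  fix v assume v: "v \<in> interior_vertices p"
  obtain a b r where 1: "p = a # b # r" "\<And>v. v \<in> set (b # r) \<Longrightarrow> fst v \<ge> 0 \<and> snd v \<ge> 1"
    using lattice_path_split_first by metis
  obtain r' c d where 2: "p = r' @ [c, d]" "\<And>v. v \<in> set (r' @ [c]) \<Longrightarrow> snd v \<le> int k"
    "\<And>v. v \<in> set p \<Longrightarrow> fst v < int n"
    using lattice_path_split_last by metis
  have "v \<in> set (butlast (b # r))" using v 1(1) by (simp add: interior_vertices_def)
  then have "v \<in> set (b # r)" by (rule in_set_butlastD)
  moreover have "v \<in> set (r' @ [c])"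
  proof -
    have "butlast p = a # butlast (tl p)" using 1(1) by simp
    then have "v \<in> set (butlast p)" using v by (simp add: interior_vertices_def)
    then show ?thesis using 2(1) by (simp add: butlast_append)
  qed
  moreover have "v \<in> set p" using calculation(1) 1(1) by simp
  ultimately show "v \<in> {(x, y). 0 \<le> x \<and> x < int n \<and> 1 \<le> y \<and> y \<le> int k}"
    using 1(2) 2(2,3) by (auto simp: case_prod_unfold)
qed

text \<open>The first vertex has \<open>x = -1\<close> or \<open>y = 0\<close> and the last has
  \<open>y = k + 1\<close>, so inside the box the degree relations have no boundary terms.\<close>

lemma lattice_path_box:
  assumes "0 \<le> x" "1 \<le> y" "y \<le> int k"
  shows "(x, y) \<in> interior_vertices p \<longleftrightarrow> (x, y) \<in> set p"
    and "of_bool (((x - 1, y), (x, y)) \<in> path_edges p) + of_bool (((x, y - 1), (x, y)) \<in> path_edges p)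
      = (of_bool ((x, y) \<in> set p) :: nat)"
    and "of_bool (((x, y), (x + 1, y)) \<in> path_edges p) + of_bool (((x, y), (x, y + 1)) \<in> path_edges p)
      = (of_bool ((x, y) \<in> set p) :: nat)"
proof -
  obtain a b r where 1: "p = a # b # r" "fst a = - 1 \<or> snd a = 0"
    using lattice_path_split_first by metis
  obtain r' c d where 2: "p = r' @ [c, d]" "snd d = int k + 1"
    using lattice_path_split_last by metis
  have hd: "hd p \<noteq> (x, y)" using 1 assms by auto
  have last: "last p \<noteq> (x, y)" using 2 assms by auto
  show "of_bool (((x - 1, y), (x, y)) \<in> path_edges p) + of_bool (((x, y - 1), (x, y)) \<in> path_edges p)
      = (of_bool ((x, y) \<in> set p) :: nat)"
    using in_degree[OF lattice_path_steps(1,2), of x y] hd by simp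
  show "of_bool (((x, y), (x + 1, y)) \<in> path_edges p) + of_bool (((x, y), (x, y + 1)) \<in> path_edges p)
      = (of_bool ((x, y) \<in> set p) :: nat)"
    using out_degree[OF lattice_path_steps(1,2), of x y] last by simp
  have "set p = insert (hd p) (insert (last p) (interior_vertices p))"
  proof -
    have "set (b # r) = insert (last (b # r)) (set (butlast (b # r)))"
      by (metis Un_insert_right append_butlast_last_id list.distinct(1) list.simps(15) set_append sup_bot.right_neutral list.set(1))
    then show ?thesis using 1(1) by (auto simp: interior_vertices_def)
  qed
  then show "(x, y) \<in> interior_vertices p \<longleftrightarrow> (x, y) \<in> set p" using hd last by auto
qed

text \<open>All vertices after the first have nonnegative \<open>x\<close>, so an edge out of column
  \<open>-1\<close> can only be the first one.\<close>

lemma lattice_path_left_edge: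
  "((- 1, y), (0, y)) \<in> path_edges p \<longleftrightarrow> first_edge p = ((- 1, y), (0, y))"
proof -
  obtain a b r where 1: "p = a # b # r" "first_edge p = (a, b)"
    "\<And>v. v \<in> set (b # r) \<Longrightarrow> fst v \<ge> 0 \<and> snd v \<ge> 1"
    using lattice_path_split_first by metis
  have "((- 1, y), (0, y)) \<notin> path_edges (b # r)" using 1(3) path_edges_vertices by fastforce
  then show ?thesis using 1 by auto
qed

lemma lattice_path_bottom_edge:
  "((x, 0), (x, 1)) \<in> path_edges p \<longleftrightarrow> first_edge p = ((x, 0), (x, 1))"
proof -
  obtain a b r where 1: "p = a # b # r" "first_edge p = (a, b)"
    "\<And>v. v \<in> set (b # r) \<Longrightarrow> fst v \<ge> 0 \<and> snd v \<ge> 1"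
    using lattice_path_split_first by metis
  have "((x, 0), (x, 1)) \<notin> path_edges (b # r)" using 1(3) path_edges_vertices by fastforce
  then show ?thesis using 1 by auto
qed

lemma lattice_path_top_edge:
  "((x, int k), (x, int k + 1)) \<in> path_edges p \<longleftrightarrow> last_edge p = ((x, int k), (x, int k + 1))"
proof -
  obtain r c d where 2: "p = r @ [c, d]" "last_edge p = (c, d)"
    "\<And>v. v \<in> set (r @ [c]) \<Longrightarrow> snd v \<le> int k"
    using lattice_path_split_last by metis
  have "((x, int k), (x, int k + 1)) \<notin> path_edges (r @ [c])" using 2(3) path_edges_vertices by fastforce
  moreover have "path_edges p = insert (c, d) (path_edges (r @ [c]))"
    using path_edges_snoc[of "r @ [c]" d] 2(1) by simp
  ultimately show ?thesis using 2 by auto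
qed

lemma lattice_path_right:
  assumes "x \<ge> int n" shows "(e, (x, y)) \<notin> path_edges p" "((x, y), e) \<notin> path_edges p"
proof -
  have "v \<in> set p \<Longrightarrow> fst v < int n" for v using lattice_path_split_last by metis
  then show "(e, (x, y)) \<notin> path_edges p" "((x, y), e) \<notin> path_edges p"
    using assms path_edges_vertices by fastforce+
qed

end

text \<open>Conservation leaves one horizontal state at each column, so the sum over states
  collapses to a product.\<close>

lemma row_weight_eq_prod:
  assumes "ice_weight w" and "h 0 = e" and "\<And>x. x < m \<Longrightarrow> a x + h x = k x + h (Suc x)"
  shows "row_weight w e a k m j = (if j = h m then \<Prod>x<m. w (a x) (h x) (k x) (h (Suc x)) else 0)"
  using assms(3)
proof (induction m arbitrary: j)
  case (Suc m)
  interpret ice_weight w by fact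
  let ?P = "\<Prod>x<m. w (a x) (h x) (k x) (h (Suc x))"
  have IH: "row_weight w e a k m i = (if i = h m then ?P else 0)" for i using Suc by simp
  have cons: "a m + h m = k m + h (Suc m)" using Suc.prems by simp
  have z1: "w (a m) (h m) (k m) j = 0" if "j \<noteq> h (Suc m)"
    using conserve[of "a m" "h m" "k m" j] cons that by auto
  \<comment> \<open>A collection may send several paths through one horizontal edge, a state that
    the row sum omits; the product then vanishes as well.\<close>
  have z2: "w (a m) (h m) (k m) j = 0" if "h m > 1"
    using horizontal_le[of "a m" "h m" "k m" j] that by auto
  have "row_weight w e a k (Suc m) j = ?P * w (a m) (h m) (k m) j"
  proof (cases "h m > 1")
    case False
    then have "h m = 0 \<or> h m = 1" by linarith
    then show ?thesis by (auto simp: IH)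
  qed (use z2 in \<open>simp add: IH\<close>)
  then show ?case using z1 by simp
qed (use assms(2) in auto)

text \<open>F and G are treated together: \<open>e\<close> is the number of paths entering each row
  from the left, \<open>1\<close> for F and \<open>0\<close> for G.\<close>

definition start_edges :: "int list \<Rightarrow> nat \<Rightarrow> nat \<Rightarrow> edge multiset" where
  "start_edges \<mu> e k = vertical_edges \<mu> 0 + (if e = 1 then left_edges k else {#})"

locale path_rows =
  fixes \<mu> :: "int list" and L e n :: nat
  assumes \<mu>: "\<mu> \<in> Sign_plus L" and e: "e \<le> 1" and \<mu>n: "\<forall>x\<in>set \<mu>. x < int n" and n: "n > 0"
begin

definition collections :: "nat \<Rightarrow> int list \<Rightarrow> vertex list multiset set" where
  "collections k \<kappa> = path_collections (start_edges \<mu> e k) (vertical_edges \<kappa> (int k))"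

definition V :: "vertex list multiset \<Rightarrow> nat \<Rightarrow> nat \<Rightarrow> nat" where
  "V C y x = edge_count C ((int x, int y), (int x, int y + 1))"

text \<open>\<open>H\<close> is indexed by the end of the edge, \<open>V\<close> by its beginning.\<close>

definition H :: "vertex list multiset \<Rightarrow> nat \<Rightarrow> nat \<Rightarrow> nat" where
  "H C y x = edge_count C ((int x - 1, int y), (int x, int y))"

context
  fixes k \<kappa> C
  assumes \<kappa>n: "\<forall>x\<in>set \<kappa>. x < int n" and C: "C \<in> collections k \<kappa>"
begin

lemma collection_parts:
  "image_mset first_edge C = start_edges \<mu> e k" "image_mset last_edge C = vertical_edges \<kappa> (int k)"
  "\<And>p. p \<in># C \<Longrightarrow> up_right_path p"
  using C by (auto simp: collections_def path_collections_def)

lemma collection_lattice_path: "p \<in># C \<Longrightarrow> lattice_path k n p"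
proof -
  assume p: "p \<in># C"
  then have "first_edge p \<in># image_mset first_edge C" "last_edge p \<in># image_mset last_edge C" by auto
  then show ?thesis
    using collection_parts(3)[OF p] \<kappa>n \<mu> unfolding lattice_path_def collection_parts(1,2) start_edges_def
    by (auto simp: in_vertical_edges in_left_edges Sign_plus_def split: if_splits)
qed

lemma collection_first: "edge_count C E = count (start_edges \<mu> e k) E"
  if "\<And>p. lattice_path k n p \<Longrightarrow> E \<in> path_edges p \<longleftrightarrow> first_edge p = E"
proof -
  have "count (start_edges \<mu> e k) E = size {#p \<in># C. first_edge p = E#}"
    unfolding collection_parts(1)[symmetric] by (rule count_image_mset_size)
  also have "{#p \<in># C. first_edge p = E#} = {#p \<in># C. E \<in> path_edges p#}"
    using collection_lattice_path that by (intro filter_mset_cong refl) auto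
  finally show ?thesis by (simp add: edge_count_def)
qed

lemma V_bottom: "V C 0 = occ \<mu>"
proof
  fix x
  have "edge_count C ((int x, 0), (int x, 1)) = count (start_edges \<mu> e k) ((int x, 0), (int x, 1))"
    by (rule collection_first) (rule lattice_path_bottom_edge)
  also have "\<dots> = count (vertical_edges \<mu> 0) ((int x, 0), (int x, 0 + 1))"
    by (auto simp: start_edges_def in_left_edges count_eq_zero_iff simp del: count_greater_zero_iff)
  finally show "V C 0 x = occ \<mu> x" unfolding count_vertical_edges by (simp add: V_def)
qed

lemma V_top: "V C k = occ \<kappa>"
proof
  fix x
  let ?E = "((int x, int k), (int x, int k + 1))"
  have "occ \<kappa> x = size {#p \<in># C. last_edge p = ?E#}"
    unfolding count_vertical_edges[of \<kappa> "int k" x, symmetric] collection_parts(2)[symmetric]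
    by (rule count_image_mset_size)
  also have "{#p \<in># C. last_edge p = ?E#} = {#p \<in># C. ?E \<in> path_edges p#}"
    using lattice_path_top_edge[OF collection_lattice_path] by (intro filter_mset_cong refl) auto
  finally show "V C k x = occ \<kappa> x" by (simp add: edge_count_def V_def)
qed

lemma H_left: "H C y 0 = e" if "1 \<le> y" "y \<le> k"
proof -
  have "edge_count C ((- 1, int y), (0, int y)) = count (start_edges \<mu> e k) ((- 1, int y), (0, int y))"
    by (rule collection_first) (rule lattice_path_left_edge)
  also have "\<dots> = (if e = 1 then count (left_edges k) ((- 1, int y), (0, int y)) else 0)"
    by (auto simp: start_edges_def in_vertical_edges count_eq_zero_iff)
  also have "\<dots> = e" using e that by (auto simp: count_left_edges)
  finally show ?thesis by (simp add: H_def)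
qed

lemma H_right: "H C y x = 0" if "x \<ge> n"
  unfolding H_def edge_count_def
  using lattice_path_right(1)[OF collection_lattice_path, of _ "int x"] that by (auto simp: filter_mset_eq_conv)

lemma V_right: "V C y x = 0" if "x \<ge> n"
  unfolding V_def edge_count_def
  using lattice_path_right(1)[OF collection_lattice_path, of _ "int x"] that by (auto simp: filter_mset_eq_conv)

lemma sums_at_vertex:
  assumes "1 \<le> y" "y \<le> k"
  shows "H C y x + V C (y - 1) x = size {#p \<in># C. (int x, int y) \<in> set p#}"
    and "H C y (Suc x) + V C y x = size {#p \<in># C. (int x, int y) \<in> set p#}"
proof -
  have y: "1 \<le> int y" "int y \<le> int k" "int (y - 1) = int y - 1" using assms by auto
  have s: "int (Suc x) - 1 = int x" "int (Suc x) = int x + 1" by auto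
  show "H C y x + V C (y - 1) x = size {#p \<in># C. (int x, int y) \<in> set p#}"
    unfolding H_def V_def edge_count_def size_filter_mset_sum sum_mset.distrib[symmetric] y(3)
    using lattice_path_box(2)[OF collection_lattice_path _ y(1,2), of _ "int x"]
    by (intro arg_cong[where f = sum_mset] image_mset_cong) auto
  show "H C y (Suc x) + V C y x = size {#p \<in># C. (int x, int y) \<in> set p#}"
    unfolding H_def V_def edge_count_def size_filter_mset_sum sum_mset.distrib[symmetric] s
    using lattice_path_box(3)[OF collection_lattice_path _ y(1,2), of _ "int x"]
    by (intro arg_cong[where f = sum_mset] image_mset_cong) auto
qed

lemma flow_conservation:
  assumes "1 \<le> y" "y \<le> k"
  shows "V C (y - 1) x + H C y x = V C y x + H C y (Suc x)"
  using sums_at_vertex[OF assms, of x] by simp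

lemma V_occ_below: "y \<le> k \<Longrightarrow> V C y \<in> occ_below (L + e * y) n"
proof (induction y)
  case 0
  then show ?case using V_bottom occ_Sign_plus[OF \<mu> \<mu>n] by simp
next
  case (Suc y)
  \<comment> \<open>Flux balance over the first \<open>m\<close> columns; at \<open>m = n\<close>
    nothing leaves to the right, so the row adds exactly \<open>e\<close> paths.\<close>
  have "(\<Sum>x<m. V C y x) + e = (\<Sum>x<m. V C (Suc y) x) + H C (Suc y) m" for m
  proof (induction m)
    case (Suc m)
    then show ?case using flow_conservation[of "Suc y" m] \<open>Suc y \<le> k\<close> by simp
  qed (use H_left[of "Suc y"] Suc.prems in simp)
  from this[of n] show ?case using Suc H_right[of n "Suc y"] V_right[of _ "Suc y"]
    by (auto simp: occ_below_def)
qed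

text \<open>Inside the box a vertex is interior to some path exactly when some path enters it, so
  even the domain of the configuration can be read off from the edge counts.\<close>

lemma configuration_of_collection:
  "configuration_of C (X, Y) =
    (if 0 \<le> X \<and> 1 \<le> Y \<and> Y \<le> int k \<and> H C (nat Y) (nat X) + V C (nat Y - 1) (nat X) > 0
     then Some (V C (nat Y - 1) (nat X), H C (nat Y) (nat X), V C (nat Y) (nat X), H C (nat Y) (Suc (nat X)))
     else None)"
proof (cases "0 \<le> X \<and> 1 \<le> Y \<and> Y \<le> int k")
  case True
  define x y where "x = nat X" and "y = nat Y"
  have y: "X = int x" "Y = int y" "1 \<le> y" "y \<le> k" "int (y - 1) = int y - 1" "int (Suc x) = int x + 1"
    using True by (auto simp: x_def y_def)
  have "(int x, int y) \<in> (\<Union>p\<in>set_mset C. interior_vertices p) \<longleftrightarrow> (\<exists>p\<in>#C. (int x, int y) \<in> set p)"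
    using lattice_path_box(1)[OF collection_lattice_path] y by auto
  also have "\<dots> \<longleftrightarrow> size {#p \<in># C. (int x, int y) \<in> set p#} > 0"
    by (auto simp: nonempty_has_size[symmetric] filter_mset_eq_conv)
  also have "\<dots> \<longleftrightarrow> H C y x + V C (y - 1) x > 0"
    using sums_at_vertex(1)[OF y(3,4), of x] by simp
  finally have "configuration_of C (int x, int y) = (if H C y x + V C (y - 1) x > 0
      then Some (V C (y - 1) x, H C y x, V C y x, H C y (Suc x)) else None)"
    unfolding configuration_of_def H_def V_def y(5,6) by simp
  then show ?thesis using y by simp
next
  case False
  then have "(X, Y) \<notin> (\<Union>p\<in>set_mset C. interior_vertices p)"
    using lattice_path_interior[OF collection_lattice_path] by fastforce
  then show ?thesis using False by (auto simp: configuration_of_def)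
qed

lemma configuration_weight_collection:
  assumes ice: "\<And>i. i \<in> {1..k} \<Longrightarrow> ice_weight (vertex_weight q s (u i))"
  shows "configuration_weight q s u (configuration_of C) =
    (\<Prod>y\<in>{1..k}. row_total (vertex_weight q s (u y)) e (V C (y - 1)) (V C y))"
proof -
  let ?f = "\<lambda>(y, x). vertex_weight q s (u y) (V C (y - 1) x) (H C y x) (V C y x) (H C y (Suc x))"
  let ?D = "{(y, x). (y, x) \<in> {1..k} \<times> {..<n} \<and> H C y x + V C (y - 1) x > 0}"
  have "configuration_weight q s u (configuration_of C) = (\<Prod>p\<in>?D. ?f p)"
    unfolding configuration_weight_def
  proof (rule prod.reindex_bij_witness[where i = "\<lambda>(y, x). (int x, int y)" and j = "\<lambda>(X, Y). (nat Y, nat X)"])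
    fix a assume a: "a \<in> dom (configuration_of C)"
    obtain X Y where XY: "a = (X, Y)" by fastforce
    then have d: "0 \<le> X \<and> 1 \<le> Y \<and> Y \<le> int k \<and> H C (nat Y) (nat X) + V C (nat Y - 1) (nat X) > 0"
      using a configuration_of_collection[of X Y] by (auto split: if_splits)
    show "(case case a of (X, Y) \<Rightarrow> (nat Y, nat X) of (y, x) \<Rightarrow> (int x, int y)) = a"
      using XY d by auto
    have "nat X < n" using H_right[of "nat X"] V_right[of "nat X"] d by (metis add.right_neutral less_irrefl not_less)
    then show "(case a of (X, Y) \<Rightarrow> (nat Y, nat X)) \<in> ?D" using XY d by auto
    show "?f (case a of (X, Y) \<Rightarrow> (nat Y, nat X)) = (case the (configuration_of C a) of
        (i1, j1, i2, j2) \<Rightarrow> vertex_weight q s (u (nat (snd a))) i1 j1 i2 j2)"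
      using XY d configuration_of_collection[of X Y] by simp
  next
    fix b assume "b \<in> ?D"
    then obtain y x where b: "b = (y, x)" "1 \<le> y" "y \<le> k" "H C y x + V C (y - 1) x > 0" by auto
    show "(case case b of (y, x) \<Rightarrow> (int x, int y) of (X, Y) \<Rightarrow> (nat Y, nat X)) = b" using b by simp
    show "(case b of (y, x) \<Rightarrow> (int x, int y)) \<in> dom (configuration_of C)"
      using b configuration_of_collection[of "int x" "int y"] by auto
  qed
  \<comment> \<open>Unvisited vertices have weight one, so the product extends to the whole box and
    can then be split into rows.\<close>
  also have "\<dots> = (\<Prod>p\<in>{1..k} \<times> {..<n}. ?f p)"
  proof (rule prod.mono_neutral_left)
    show "\<forall>p\<in>{1..k} \<times> {..<n} - ?D. ?f p = 1"
    proof
      fix p assume "p \<in> {1..k} \<times> {..<n} - ?D"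
      moreover obtain y x where "p = (y, x)" by (cases p)
      ultimately have p: "p = (y, x)" "y \<in> {1..k}" "H C y x = 0" "V C (y - 1) x = 0" by auto
      then have "V C y x = 0" "H C y (Suc x) = 0" using flow_conservation[of y x] by auto
      then show "?f p = 1" using p ice_weight.empty_vertex[OF ice] by simp
    qed
  qed auto
  also have "\<dots> = (\<Prod>y\<in>{1..k}. \<Prod>x<n. ?f (y, x))" by (simp add: prod.cartesian_product)
  also have "\<dots> = (\<Prod>y\<in>{1..k}. row_total (vertex_weight q s (u y)) e (V C (y - 1)) (V C y))"
  proof (rule prod.cong[OF refl])
    fix y assume y: "y \<in> {1..k}"
    interpret ice_weight "vertex_weight q s (u y)" by (rule ice[OF y])
    have "row_total (vertex_weight q s (u y)) e (V C (y - 1)) (V C y)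
        = row_weight (vertex_weight q s (u y)) e (V C (y - 1)) (V C y) n 0"
      using V_right by (intro row_total_eq) auto
    also have "\<dots> = (\<Prod>x<n. ?f (y, x))"
      using row_weight_eq_prod[of "vertex_weight q s (u y)" "H C y" e n "V C (y - 1)" "V C y" 0]
        ice[OF y] H_left[of y] flow_conservation[of y] H_right[of n y] y by auto
    finally show "(\<Prod>x<n. ?f (y, x)) = row_total (vertex_weight q s (u y)) e (V C (y - 1)) (V C y)" ..
  qed
  finally show ?thesis .
qed

end

end

subsection \<open>Partition functions as iterated rows\<close>

text \<open>If \<open>\<tau> ! l\<close> exceeded \<open>\<kappa> ! l\<close>, then at least
  \<open>length \<kappa> - l\<close> entries of \<open>\<kappa>\<close> but fewer of
  \<open>\<tau>\<close> would lie below \<open>t = \<tau> ! l\<close>.\<close>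

lemma sorted_dominated:
  assumes "sorted_wrt (\<ge>) \<tau>" "sorted_wrt (\<ge>) \<kappa>" "length \<tau> = length \<kappa>" "\<forall>x\<in>set \<kappa>. 0 \<le> x"
    and "\<And>t. length (filter (\<lambda>z. z < int t) \<kappa>) \<le> length (filter (\<lambda>z. z < int t) \<tau>)"
    and "l < length \<kappa>"
  shows "\<tau> ! l \<le> \<kappa> ! l"
proof (rule ccontr)
  assume "\<not> \<tau> ! l \<le> \<kappa> ! l"
  then have lt: "\<kappa> ! l < \<tau> ! l" by simp
  have "\<kappa> ! l \<ge> 0" using assms(4,6) by simp
  then obtain t where t: "\<tau> ! l = int t" using lt by (metis less_imp_le nonneg_int_cases order.trans)
  have mono: "xs ! j \<le> xs ! i" if "sorted_wrt (\<ge>) xs" "i \<le> j" "j < length xs" for xs :: "int list" and i j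
    using that sorted_wrt_nth_less[of "(\<ge>)" xs i j] by (cases "i = j") auto
  have "{l..<length \<kappa>} \<subseteq> {i. i < length \<kappa> \<and> \<kappa> ! i < int t}"
    using mono[OF assms(2), of l] lt t by fastforce
  then have "card {l..<length \<kappa>} \<le> length (filter (\<lambda>z. z < int t) \<kappa>)"
    unfolding length_filter_conv_card by (intro card_mono) auto
  moreover have "{i. i < length \<tau> \<and> \<tau> ! i < int t} \<subseteq> {Suc l..<length \<tau>}"
  proof
    fix i assume "i \<in> {i. i < length \<tau> \<and> \<tau> ! i < int t}"
    then show "i \<in> {Suc l..<length \<tau>}"
      using mono[OF assms(1), of i l] assms(3,6) t by (cases "i \<le> l") auto
  qed
  then have "length (filter (\<lambda>z. z < int t) \<tau>) \<le> card {Suc l..<length \<tau>}"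
    unfolding length_filter_conv_card by (intro card_mono) auto
  ultimately show False using assms(3,6) assms(5)[of t] by simp
qed

lemma first_edge_snoc: "2 \<le> length q \<Longrightarrow> first_edge (q @ [v]) = first_edge q"
  by (cases q) (auto simp: first_edge_def nth_append)

text \<open>A one-vertex list \<open>q\<close> stands for a path about to enter from the left: its
  first edge arises only with its first step, hence the separate clauses. The last clause keeps the
  occupations of the earlier rows unchanged.\<close>

lemma extend_right:
  assumes "q \<noteq> []" "successively unit_step q" "last q = (a, Y)" "a \<le> x"
  shows "\<exists>p. p \<noteq> [] \<and> successively unit_step p \<and> last p = (x, Y) \<and> length q \<le> length p \<and>
     (2 \<le> length q \<longrightarrow> first_edge p = first_edge q) \<and>
     (q = [(a, Y)] \<longrightarrow> a < x \<longrightarrow> 2 \<le> length p \<and> first_edge p = ((a, Y), (a + 1, Y))) \<and>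
     (q = [(a, Y)] \<longrightarrow> a = x \<longrightarrow> p = q) \<and>
     (\<forall>z y. ((z, y), (z, y + 1)) \<in> path_edges p \<longleftrightarrow> ((z, y), (z, y + 1)) \<in> path_edges q)"
  using assms(4)
proof (induction x rule: int_ge_induct)
  case base
  then show ?case using assms by (intro exI[of _ q]) auto
next
  case (step x)
  then obtain p where p: "p \<noteq> []" "successively unit_step p" "last p = (x, Y)" "length q \<le> length p"
    "2 \<le> length q \<Longrightarrow> first_edge p = first_edge q"
    "q = [(a, Y)] \<Longrightarrow> a < x \<Longrightarrow> 2 \<le> length p \<and> first_edge p = ((a, Y), (a + 1, Y))"
    "q = [(a, Y)] \<Longrightarrow> a = x \<Longrightarrow> p = q"
    "\<And>z y. ((z, y), (z, y + 1)) \<in> path_edges p \<longleftrightarrow> ((z, y), (z, y + 1)) \<in> path_edges q"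
    by blast
  let ?p = "p @ [(x + 1, Y)]"
  have "successively unit_step ?p" using p(1-3) by (simp add: successively_append_iff)
  moreover have "2 \<le> length q \<longrightarrow> first_edge ?p = first_edge q"
    using p(4,5) by (simp add: first_edge_snoc)
  moreover have "q = [(a, Y)] \<longrightarrow> 2 \<le> length ?p \<and> first_edge ?p = ((a, Y), (a + 1, Y))"
  proof (cases "a < x")
    case True
    then show ?thesis using p(6) by (auto simp: first_edge_snoc)
  next
    case False
    then have "a = x" using step.hyps by simp
    then show ?thesis using p(7) by (auto simp: first_edge_def)
  qed
  moreover have "\<forall>z y. ((z, y), (z, y + 1)) \<in> path_edges ?p \<longleftrightarrow> ((z, y), (z, y + 1)) \<in> path_edges q"
    using p(1,3,8) by (auto simp: path_edges_snoc)
  ultimately show ?case using p(4) step.hyps by (intro exI[of _ ?p]) auto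
qed

lemma extend_row:
  assumes "q \<noteq> []" "successively unit_step q" "last q = (a, Y)" "a \<le> x"
    and "2 \<le> length q \<or> q = [(a, Y)] \<and> a < x"
  shows "\<exists>p. up_right_path p \<and> last_edge p = ((x, Y), (x, Y + 1)) \<and>
     first_edge p = (if 2 \<le> length q then first_edge q else ((a, Y), (a + 1, Y))) \<and>
     (\<forall>z y. y < Y \<longrightarrow> ((z, y), (z, y + 1)) \<in> path_edges p \<longleftrightarrow> ((z, y), (z, y + 1)) \<in> path_edges q)"
proof -
  obtain p where p: "p \<noteq> []" "successively unit_step p" "last p = (x, Y)" "length q \<le> length p"
    "2 \<le> length q \<Longrightarrow> first_edge p = first_edge q"
    "q = [(a, Y)] \<Longrightarrow> a < x \<Longrightarrow> 2 \<le> length p \<and> first_edge p = ((a, Y), (a + 1, Y))"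
    "\<And>z y. ((z, y), (z, y + 1)) \<in> path_edges p \<longleftrightarrow> ((z, y), (z, y + 1)) \<in> path_edges q"
    using extend_right[OF assms(1-4)] by blast
  have len: "2 \<le> length p" using p(4,6) assms(5) by auto
  let ?p = "p @ [(x, Y + 1)]"
  have "up_right_path ?p"
    using p(1-3) len by (simp add: up_right_path_def successively_append_iff)
  moreover have "last_edge ?p = ((x, Y), (x, Y + 1))"
    using p(1,3) by (simp add: last_edge_def nth_append last_conv_nth)
  moreover have "first_edge ?p = (if 2 \<le> length q then first_edge q else ((a, Y), (a + 1, Y)))"
    using p(5,6) assms(5) len by (auto simp: first_edge_snoc)
  moreover have "\<forall>z y. y < Y \<longrightarrow> ((z, y), (z, y + 1)) \<in> path_edges ?p \<longleftrightarrow> ((z, y), (z, y + 1)) \<in> path_edges q"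
    using p(1,3,7) by (auto simp: path_edges_snoc)
  ultimately show ?thesis by blast
qed

text \<open>Used to order the paths of a collection like the entries of the signature at which they
  end.\<close>

lemma mset_image_listing:
  assumes "image_mset f C = mset xs"
  obtains ys where "mset ys = C" "map f ys = xs"
  using assms
proof (induction xs arbitrary: C thesis)
  case (Cons x xs)
  then have "x \<in># image_mset f C" by simp
  then obtain c where c: "c \<in># C" "f c = x" by auto
  then have "image_mset f (C - {#c#}) = mset xs" using Cons.prems(2) by (simp add: image_mset_Diff)
  then obtain ys where "mset ys = C - {#c#}" "map f ys = xs" using Cons.IH by blast
  then show ?case using Cons.prems(1)[of "c # ys"] c by simp
qed simp

section \<open>Realizing occupations by paths\<close>

context path_rows
begin

text \<open>Paths and end points are matched in decreasing order; the prefix inequalities then put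
  every end point weakly to the right of the path sent to it.\<close>

lemma extend_collection:
  assumes \<tau>: "\<tau> \<in> Sign_plus (L + e * k)" "\<forall>x\<in>set \<tau>. x < int n"
    and \<kappa>: "\<kappa> \<in> Sign_plus (L + e * Suc k)" "\<forall>x\<in>set \<kappa>. x < int n"
    and dominated: "\<And>t. (\<Sum>x<t. occ \<kappa> x) \<le> e + (\<Sum>x<t. occ \<tau> x)"
    and C: "C \<in> collections k \<tau>"
  shows "\<exists>C'\<in>collections (Suc k) \<kappa>. \<forall>y\<le>k. V C' y = V C y"
proof -
  let ?Y = "int k + 1"
  have "image_mset last_edge C = mset (map (\<lambda>x. ((x, int k), (x, int k + 1))) \<tau>)"
    using C by (simp add: collections_def path_collections_def vertical_edges_def)
  then obtain ps where ps: "mset ps = C" "map last_edge ps = map (\<lambda>x. ((x, int k), (x, int k + 1))) \<tau>"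
    by (rule mset_image_listing)
  \<comment> \<open>A path entering from the left is treated as standing at column
    \<open>-1\<close>. Appended last it keeps the list decreasing, and it is counted below every
    \<open>t\<close>, which accounts for the summand \<open>e\<close>.\<close>
  define \<tau>' where "\<tau>' = \<tau> @ replicate e (- 1)"
  define qs where "qs = ps @ replicate e [(- 1, ?Y)]"
  have nonneg: "\<forall>x\<in>set \<tau>. 0 \<le> x" "\<forall>x\<in>set \<kappa>. 0 \<le> x" using \<tau> \<kappa> by (auto simp: Sign_plus_def)
  have len: "length \<tau>' = length \<kappa>" "length qs = length \<kappa>" "length ps = length \<tau>"
    using \<tau>(1) \<kappa>(1) map_eq_imp_length_eq[OF ps(2)]
    by (auto simp: \<tau>'_def qs_def Sign_plus_def Sign_def)
  have e01: "e = 0 \<or> e = 1" using e by linarith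
  have dom: "\<tau>' ! l \<le> \<kappa> ! l" if "l < length \<kappa>" for l
  proof (rule sorted_dominated)
    show "sorted_wrt (\<ge>) \<tau>'"
      using \<tau>(1) nonneg(1) e01 by (auto simp: \<tau>'_def Sign_plus_def Sign_def sorted_wrt_append)
    show "length (filter (\<lambda>z. z < int t) \<kappa>) \<le> length (filter (\<lambda>z. z < int t) \<tau>')" for t
      using dominated[of t] sum_occ[OF nonneg(1), of t] sum_occ[OF nonneg(2), of t]
      by (simp add: \<tau>'_def)
  qed (use len \<kappa> that in \<open>auto simp: Sign_plus_def Sign_def\<close>)
  define P where "P l p \<longleftrightarrow> up_right_path p \<and> last_edge p = ((\<kappa> ! l, ?Y), (\<kappa> ! l, ?Y + 1)) \<and>
     first_edge p = (if l < length ps then first_edge (ps ! l) else ((- 1, ?Y), (0, ?Y))) \<and>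
     (\<forall>z y. y < ?Y \<longrightarrow> ((z, y), (z, y + 1)) \<in> path_edges p \<longleftrightarrow> ((z, y), (z, y + 1)) \<in> path_edges (qs ! l))" for l p
  have "\<exists>p. P l p"
    if l: "l < length \<kappa>" for l
  proof (cases "l < length ps")
    case True
    then have q: "qs ! l = ps ! l" "\<tau>' ! l = \<tau> ! l" using len by (auto simp: qs_def \<tau>'_def nth_append)
    have lp: "lattice_path k n (ps ! l)"
      using collection_lattice_path[OF \<tau>(2) C] True ps(1) by (metis nth_mem set_mset_mset)
    have "last_edge (ps ! l) = ((\<tau> ! l, int k), (\<tau> ! l, ?Y))"
      using arg_cong[OF ps(2), of "\<lambda>xs. xs ! l"] True len by simp
    then have "last (ps ! l) = (\<tau>' ! l, ?Y)"
      using lattice_path_steps(2)[OF lp] q by (simp add: last_edge_def last_conv_nth)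
    from extend_row[OF lattice_path_steps(2,1)[OF lp] this dom[OF l]] lattice_path_steps(3)[OF lp] True
    show ?thesis unfolding q P_def by auto
  next
    case False
    then have q: "qs ! l = [(- 1, ?Y)]" using l len by (simp add: qs_def nth_append)
    have "\<kappa> ! l \<ge> 0" using l nonneg by simp
    then show ?thesis
      using extend_row[of "qs ! l" "- 1" ?Y "\<kappa> ! l"] False unfolding q P_def by auto
  qed
  then obtain R where "\<And>l. l < length \<kappa> \<Longrightarrow> P l (R l)" by metis
  then have R: "\<And>l. l < length \<kappa> \<Longrightarrow> up_right_path (R l)"
    "\<And>l. l < length \<kappa> \<Longrightarrow> last_edge (R l) = ((\<kappa> ! l, ?Y), (\<kappa> ! l, ?Y + 1))"
    "\<And>l. l < length \<kappa> \<Longrightarrow> first_edge (R l) = (if l < length ps then first_edge (ps ! l) else ((- 1, ?Y), (0, ?Y)))"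
    "\<And>l z y. l < length \<kappa> \<Longrightarrow> y < ?Y \<Longrightarrow>
       ((z, y), (z, y + 1)) \<in> path_edges (R l) \<longleftrightarrow> ((z, y), (z, y + 1)) \<in> path_edges (qs ! l)"
    unfolding P_def by blast+
  define rs where "rs = map R [0..<length \<kappa>]"
  have "map last_edge rs = map (\<lambda>x. ((x, ?Y), (x, ?Y + 1))) \<kappa>"
    using R(2) by (intro nth_equalityI) (auto simp: rs_def)
  then have last: "image_mset last_edge (mset rs) = vertical_edges \<kappa> (int (Suc k))"
    by (metis (no_types, lifting) add.commute mset_map of_nat_Suc vertical_edges_def image_mset_cong)
  have "map first_edge rs = map first_edge ps @ replicate e ((- 1, ?Y), (0, ?Y))"
    using R(3) len by (intro nth_equalityI) (auto simp: rs_def nth_append qs_def)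
  then have "image_mset first_edge (mset rs) = image_mset first_edge C + mset (replicate e ((- 1, ?Y), (0, ?Y)))"
    by (metis mset_append mset_map ps(1))
  also have "image_mset first_edge C = start_edges \<mu> e k"
    using C by (simp add: collections_def path_collections_def)
  also have "start_edges \<mu> e k + mset (replicate e ((- 1, ?Y), (0, ?Y))) = start_edges \<mu> e (Suc k)"
    using e01 by (auto simp: start_edges_def left_edges_Suc)
  finally have "mset rs \<in> collections (Suc k) \<kappa>"
    using last R(1) by (auto simp: collections_def path_collections_def rs_def)
  moreover have "V (mset rs) y x = V C y x" if "y \<le> k" for y x
  proof -
    let ?E = "((int x, int y), (int x, int y + 1))"
    have "V (mset rs) y x = length (filter (\<lambda>p. ?E \<in> path_edges p) rs)"
      by (simp add: V_def edge_count_def flip: mset_filter)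
    also have "\<dots> = length (filter (\<lambda>p. ?E \<in> path_edges p) qs)"
      unfolding length_filter_conv_card using R(4) that len(2)
      by (intro arg_cong[where f = card]) (auto simp: rs_def)
    also have "\<dots> = length (filter (\<lambda>p. ?E \<in> path_edges p) ps)"
      by (simp add: qs_def)
    also have "\<dots> = V C y x"
      by (simp add: V_def edge_count_def ps(1)[symmetric] flip: mset_filter)
    finally show ?thesis .
  qed
  ultimately show ?thesis by blast
qed

text \<open>A nonzero row weight yields the prefix inequalities by \<open>row_flux\<close>, and
  these let the collection be extended by one row.\<close>

lemma realize_chain:
  assumes "\<kappa> \<in> Sign_plus (L + e * k)" "\<forall>x\<in>set \<kappa>. x < int n"
    and "c 0 = occ \<mu>" "c k = occ \<kappa>" "\<And>y. y \<le> k \<Longrightarrow> c y \<in> occ_below (L + e * y) n"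
    and "\<And>y. y < k \<Longrightarrow> ice_weight (w (Suc y)) \<and> row_total (w (Suc y)) e (c y) (c (Suc y)) \<noteq> 0"
  shows "\<exists>C\<in>collections k \<kappa>. \<forall>y\<le>k. V C y = c y"
  using assms(1,2,4-)
proof (induction k arbitrary: \<kappa>)
  case 0
  then have "mset \<mu> = mset \<kappa>" using assms(3) \<mu> by (intro mset_eq_if_occ_eq) auto
  \<comment> \<open>With no rows every path is a single vertical edge.\<close>
  then have "image_mset (\<lambda>x. [(x, 0), (x, 1)]) (mset \<mu>) \<in> collections 0 \<kappa>"
    by (auto simp: collections_def path_collections_def start_edges_def vertical_edges_def left_edges_def
        up_right_path_def first_edge_def last_edge_def image_mset.compositionality comp_def)
  then show ?case using V_bottom[OF 0(2)] assms(3) by auto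
next
  case (Suc k)
  obtain \<tau> where \<tau>: "\<tau> \<in> Sign_plus (L + e * k)" "\<forall>x\<in>set \<tau>. x < int n" "occ \<tau> = c k"
    by (rule occ_surj[OF Suc.prems(4)[of k]]) auto
  obtain C where C: "C \<in> collections k \<tau>" "\<And>y. y \<le> k \<Longrightarrow> V C y = c y"
    using Suc.IH[OF \<tau>(1,2)] \<tau>(3) Suc.prems(4,5) by auto
  interpret ice_weight "w (Suc k)" using Suc.prems(5)[of k] by simp
  have supp: "c k \<in> occ_below (L + e * k) n" "c (Suc k) \<in> occ_below (L + e * Suc k) n"
    using Suc.prems(4)[of k] Suc.prems(4)[of "Suc k"] by auto
  have "(\<Sum>x<t. occ \<kappa> x) \<le> e + (\<Sum>x<t. occ \<tau> x)" for t
  proof -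
    have "row_total (w (Suc k)) e (c k) (c (Suc k)) = row_weight (w (Suc k)) e (c k) (c (Suc k)) (max t n) 0"
      using supp by (intro row_total_eq) (auto simp: occ_below_def)
    then have "row_weight (w (Suc k)) e (c k) (c (Suc k)) (max t n) 0 \<noteq> 0"
      using Suc.prems(5)[of k] by simp
    from row_flux[OF this e] show ?thesis using \<tau>(3) Suc.prems(3) by simp
  qed
  from extend_collection[OF \<tau>(1,2) Suc.prems(1,2) this C(1)] obtain C' where
    C': "C' \<in> collections (Suc k) \<kappa>" "\<And>y. y \<le> k \<Longrightarrow> V C' y = V C y" by blast
  then have "V C' y = c y" if "y \<le> Suc k" for y
    using that C(2) V_top[OF Suc.prems(2) C'(1)] Suc.prems(3) by (cases "y = Suc k") auto
  then show ?case using C' by blast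
qed

text \<open>\<open>extensional\<close> fixes the values beyond \<open>k\<close>, so the sum over
  chains counts each family of occupations once.\<close>

definition chains :: "nat \<Rightarrow> (nat \<Rightarrow> nat) \<Rightarrow> (nat \<Rightarrow> nat \<Rightarrow> nat) set" where
  "chains k f = {c \<in> extensional {..k}. c 0 = occ \<mu> \<and> c k = f \<and> (\<forall>y\<le>k. c y \<in> occ_below (L + e * y) n)}"

lemma finite_chains: "finite (chains k f)"
proof (rule finite_subset)
  show "chains k f \<subseteq> (\<Pi>\<^sub>E y\<in>{..k}. occ_below (L + e * y) n)"
    by (auto simp: chains_def PiE_def)
qed (auto intro!: finite_PiE finite_occ_below)

lemma sum_chains:
  assumes ice: "\<And>i. i \<in> {1..k} \<Longrightarrow> ice_weight (w i)" and "f \<in> occ_below (L + e * k) n"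
  shows "(\<Sum>c\<in>chains k f. \<Prod>y\<in>{1..k}. row_total (w y) e (c (y - 1)) (c y))
    = iterate_rows w e L (occ \<mu>) k f"
  using assms
proof (induction k arbitrary: f)
  case 0
  have "chains 0 f = (if f = occ \<mu> then {restrict (\<lambda>_. occ \<mu>) {..0}} else {})"
    using 0(2) by (auto simp: chains_def extensional_def fun_eq_iff)
  then show ?case by simp
next
  case (Suc k)
  interpret ice_weight "w (Suc k)" using Suc.prems(1) by simp
  let ?W = "\<lambda>k c. \<Prod>y\<in>{1..k}. row_total (w y) e (c (y - 1)) (c y)"
  let ?S = "occ_below (L + e * k) n"
  \<comment> \<open>\<open>f\<close> lives below column \<open>n\<close>, hence so does every lower
    occupation that contributes, and the infinite sum becomes finite.\<close>
  have "iterate_rows w e L (occ \<mu>) (Suc k) f =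
      (\<Sum>\<^sub>\<infinity>t\<in>?S. iterate_rows w e L (occ \<mu>) k t * row_total (w (Suc k)) e t f)"
    unfolding iterate_rows.simps
    using row_total_support[OF _ e, of _ f "L + e * k" "L + e * Suc k" n] Suc.prems(2) occ_below_occs
    by (intro infsum_cong_neutral) auto
  also have "\<dots> = (\<Sum>t\<in>?S. (\<Sum>c\<in>chains k t. ?W k c) * row_total (w (Suc k)) e t f)"
    using Suc.IH Suc.prems(1) by (simp add: finite_occ_below)
  also have "\<dots> = (\<Sum>(t, c)\<in>(SIGMA t:?S. chains k t). ?W k c * row_total (w (Suc k)) e t f)"
    unfolding sum_distrib_right by (rule sum.Sigma) (auto simp: finite_occ_below finite_chains)
  also have "\<dots> = (\<Sum>c\<in>chains (Suc k) f. ?W (Suc k) c)"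
  proof (rule sum.reindex_bij_witness[where i = "\<lambda>c. (c k, restrict c {..k})" and j = "\<lambda>(t, c). c(Suc k := f)"])
    fix c assume c: "c \<in> chains (Suc k) f"
    then show "(c k, restrict c {..k}) \<in> (SIGMA t:?S. chains k t)"
      by (auto simp: chains_def)
    show "(case (c k, restrict c {..k}) of (t, c) \<Rightarrow> c(Suc k := f)) = c"
      using c by (auto simp: chains_def fun_eq_iff extensional_def restrict_def le_Suc_eq)
  next
    fix a assume "a \<in> (SIGMA t:?S. chains k t)"
    then obtain t c where a: "a = (t, c)" "t \<in> ?S" "c \<in> chains k t" by auto
    show "(case a of (t, c) \<Rightarrow> c(Suc k := f)) \<in> chains (Suc k) f"
      using a Suc.prems(2) by (auto simp: chains_def extensional_def le_Suc_eq)
    show "((case a of (t, c) \<Rightarrow> c(Suc k := f)) k, restrict (case a of (t, c) \<Rightarrow> c(Suc k := f)) {..k}) = a"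
      using a by (auto simp: chains_def fun_eq_iff extensional_def restrict_def)
    have "?W k (c(Suc k := f)) = ?W k c" by (intro prod.cong) auto
    then show "?W (Suc k) (case a of (t, c) \<Rightarrow> c(Suc k := f)) =
        (case a of (t, c) \<Rightarrow> ?W k c * row_total (w (Suc k)) e t f)"
      using a by (simp add: chains_def)
  qed
  finally show ?case ..
qed

text \<open>A configuration and the family of its row occupations determine each other, because the
  horizontal edges follow from the vertical ones by conservation of paths.\<close>

theorem partition_function_eq_iterate_rows:
  assumes \<kappa>: "\<kappa> \<in> Sign_plus (L + e * k)" "\<forall>x\<in>set \<kappa>. x < int n"
    and ice: "\<And>i. i \<in> {1..k} \<Longrightarrow> ice_weight (vertex_weight q s (u i))"
  shows "partition_function q s u (start_edges \<mu> e k) (vertical_edges \<kappa> (int k)) =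
    iterate_rows (\<lambda>i. vertex_weight q s (u i)) e L (occ \<mu>) k (occ \<kappa>)"
proof -
  let ?W = "\<lambda>c. \<Prod>y\<in>{1..k}. row_total (vertex_weight q s (u y)) e (c (y - 1)) (c y)"
  \<comment> \<open>The third component counts the paths leaving upwards, and an undefined vertex
    has none. Row \<open>0\<close> is not recorded in a configuration, so its occupation is supplied
    by hand.\<close>
  define \<phi> :: "configuration \<Rightarrow> nat \<Rightarrow> nat \<Rightarrow> nat" where
    "\<phi> g = (\<lambda>y\<in>{..k}. if y = 0 then occ \<mu> else
       (\<lambda>x. case g (int x, int y) of None \<Rightarrow> 0 | Some (_, _, m, _) \<Rightarrow> m))" for g
  have \<phi>: "\<phi> (configuration_of C) = restrict (V C) {..k}" if C: "C \<in> collections k \<kappa>" for C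
  proof
    fix y
    show "\<phi> (configuration_of C) y = restrict (V C) {..k} y"
    proof (cases "1 \<le> y \<and> y \<le> k")
      case True
      have "(case configuration_of C (int x, int y) of None \<Rightarrow> 0 | Some (_, _, m, _) \<Rightarrow> m) = V C y x" for x
        using configuration_of_collection[OF \<kappa>(2) C, of "int x" "int y"]
          flow_conservation[OF \<kappa>(2) C, of y x] True by auto
      then show ?thesis using True by (auto simp: \<phi>_def)
    qed (use V_bottom[OF \<kappa>(2) C] in \<open>auto simp: \<phi>_def\<close>)
  qed
  have inj: "inj_on \<phi> (configuration_of ` collections k \<kappa>)"
  proof (rule inj_onI, elim imageE)
    fix g g' C C' assume C: "C \<in> collections k \<kappa>" "C' \<in> collections k \<kappa>"
      and g: "g = configuration_of C" "g' = configuration_of C'" "\<phi> g = \<phi> g'"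
    have V: "V C y = V C' y" if "y \<le> k" for y
      using fun_cong[OF g(3)[unfolded g(1,2) \<phi>[OF C(1)] \<phi>[OF C(2)]], of y] that by simp
    have H: "H C y x = H C' y x" if "1 \<le> y" "y \<le> k" for y x
    proof (induction x)
      case 0
      then show ?case using H_left[OF \<kappa>(2) C(1) that] H_left[OF \<kappa>(2) C(2) that] by simp
    next
      case (Suc x)
      then show ?case
        using flow_conservation[OF \<kappa>(2) C(1) that, of x] flow_conservation[OF \<kappa>(2) C(2) that, of x]
          V[of y] V[of "y - 1"] that by simp
    qed
    show "g = g'"
    proof
      fix a :: vertex
      obtain X Y where a: "a = (X, Y)" by fastforce
      show "g a = g' a"
        unfolding a g(1,2) configuration_of_collection[OF \<kappa>(2) C(1)] configuration_of_collection[OF \<kappa>(2) C(2)]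
        using V[of "nat Y"] V[of "nat Y - 1"] H[of "nat Y"] by auto
    qed
  qed
  have "partition_function q s u (start_edges \<mu> e k) (vertical_edges \<kappa> (int k)) =
      (\<Sum>g\<in>configuration_of ` collections k \<kappa>. ?W (\<phi> g))"
    unfolding partition_function_def collections_def[symmetric]
  proof (intro sum.cong refl, elim imageE)
    fix g C assume g: "g = configuration_of C" "C \<in> collections k \<kappa>"
    have "?W (restrict (V C) {..k}) = ?W (V C)" by (intro prod.cong) auto
    then show "configuration_weight q s u g = ?W (\<phi> g)"
      using configuration_weight_collection[OF \<kappa>(2) g(2) ice] \<phi>[OF g(2)] g(1) by simp
  qed
  also have "\<dots> = (\<Sum>c\<in>\<phi> ` configuration_of ` collections k \<kappa>. ?W c)"
    by (simp only: sum.reindex[OF inj] comp_def)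
  also have "\<dots> = (\<Sum>c\<in>chains k (occ \<kappa>). ?W c)"
  proof (rule sum.mono_neutral_left[OF finite_chains])
    show "\<phi> ` configuration_of ` collections k \<kappa> \<subseteq> chains k (occ \<kappa>)"
    proof
      fix c assume "c \<in> \<phi> ` configuration_of ` collections k \<kappa>"
      then obtain C where C: "C \<in> collections k \<kappa>" "c = restrict (V C) {..k}" using \<phi> by auto
      then show "c \<in> chains k (occ \<kappa>)"
        using V_bottom[OF \<kappa>(2) C(1)] V_top[OF \<kappa>(2) C(1)] V_occ_below[OF \<kappa>(2) C(1)]
        by (auto simp: chains_def)
    qed
    \<comment> \<open>By \<open>realize_chain\<close> a chain without a vanishing row weight comes
      from a collection.\<close>
    show "\<forall>c\<in>chains k (occ \<kappa>) - \<phi> ` configuration_of ` collections k \<kappa>. ?W c = 0"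
    proof (rule ballI, rule ccontr)
      fix c assume c: "c \<in> chains k (occ \<kappa>) - \<phi> ` configuration_of ` collections k \<kappa>" and "?W c \<noteq> 0"
      then have "row_total (vertex_weight q s (u (Suc y))) e (c y) (c (Suc y)) \<noteq> 0" if "y < k" for y
        using that by (auto dest!: bspec[where x = "Suc y"])
      then obtain C where C: "C \<in> collections k \<kappa>" "\<forall>y\<le>k. V C y = c y"
        using realize_chain[OF \<kappa>, of c "\<lambda>i. vertex_weight q s (u i)"] c ice by (auto simp: chains_def)
      have "c = restrict (V C) {..k}"
        using C(2) c by (auto simp: chains_def extensional_def fun_eq_iff)
      then have "c = \<phi> (configuration_of C)" using \<phi>[OF C(1)] by simp
      then show False using c C(1) by blast
    qed
  qed
  also have "\<dots> = iterate_rows (\<lambda>i. vertex_weight q s (u i)) e L (occ \<mu>) k (occ \<kappa>)"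
    using ice occ_Sign_plus[OF \<kappa>] by (rule sum_chains)
  finally show ?thesis .
qed

end

subsection \<open>Conjugation and the main result\<close>

definition conj_term :: "complex \<Rightarrow> complex \<Rightarrow> nat \<Rightarrow> complex" where
  "conj_term q s m = qpoch (s\<^sup>2) q m / qpoch q q m"

definition conj_occ :: "complex \<Rightarrow> complex \<Rightarrow> (nat \<Rightarrow> nat) \<Rightarrow> complex" where
  "conj_occ q s f = (\<Prod>x | f x \<noteq> 0. conj_term q s (f x))"

lemma conj_term_0 [simp]: "conj_term q s 0 = 1"
  by (simp add: conj_term_def qpoch_def)

lemma conj_occ_below:
  "\<forall>x\<ge>n. f x = 0 \<Longrightarrow> conj_occ q s f = (\<Prod>x<n. conj_term q s (f x))"
  unfolding conj_occ_def by (intro prod.mono_neutral_left) (auto intro: leI)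

lemma qpoch_nonzero_le: "qpoch a q M \<noteq> 0 \<Longrightarrow> m \<le> M \<Longrightarrow> qpoch a q m \<noteq> 0"
  by (auto simp: qpoch_def)

lemma conj_term_Suc:
  assumes "qpoch q q (Suc m) \<noteq> 0"
  shows "conj_term q s (Suc m) * (1 - q ^ Suc m) = conj_term q s m * (1 - s\<^sup>2 * q ^ m)"
proof -
  have "qpoch q q m \<noteq> 0" "1 - q ^ Suc m \<noteq> 0" using assms by (auto simp: qpoch_def)
  then show ?thesis by (simp add: conj_term_def qpoch_def field_simps)
qed

text \<open>A gauge transformation: formally \<open>conj_weight\<close> is
  \<open>vertex_weight\<close> times the quotient of the values of \<open>conj_term\<close> at the
  upper and the lower edge. Cleared of denominators, the relation passes to products over
  columns.\<close>

lemma conj_weight_eq: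
  assumes "qpoch q q M \<noteq> 0" "a \<le> M" "k \<le> M"
  shows "conj_weight q s v a i k j * conj_term q s a = vertex_weight q s v a i k j * conj_term q s k"
proof -
  note S = conj_term_Suc[OF qpoch_nonzero_le[OF assms(1)], of _ s]
  consider "a = Suc k" | "k = Suc a" | "a \<noteq> Suc k" "k \<noteq> Suc a" by blast
  then show ?thesis
  proof cases
    case 1
    then show ?thesis using S[of k] assms by (auto simp: conj_weight_def vertex_weight_def mult_ac)
  next
    case 2
    then show ?thesis using S[of a] assms by (auto simp: conj_weight_def vertex_weight_def mult_ac)
  qed (auto simp: conj_weight_def vertex_weight_def)
qed

lemma conj_row_weight:
  assumes "qpoch q q M \<noteq> 0" "\<And>x. a x \<le> M" "\<And>x. k x \<le> M"
  shows "row_weight (conj_weight q s v) e a k n j * (\<Prod>x<n. conj_term q s (a x)) =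
    row_weight (vertex_weight q s v) e a k n j * (\<Prod>x<n. conj_term q s (k x))"
proof (induction n arbitrary: j)
  case (Suc n)
  let ?c = "conj_term q s" and ?r = "row_weight (conj_weight q s v) e a k n"
    and ?r' = "row_weight (vertex_weight q s v) e a k n"
  have "?r i * conj_weight q s v (a n) i (k n) j * (\<Prod>x<Suc n. ?c (a x)) =
      ?r' i * vertex_weight q s v (a n) i (k n) j * (\<Prod>x<Suc n. ?c (k x))" for i
  proof -
    have "?r i * conj_weight q s v (a n) i (k n) j * (\<Prod>x<Suc n. ?c (a x)) =
        (?r i * (\<Prod>x<n. ?c (a x))) * (conj_weight q s v (a n) i (k n) j * ?c (a n))"
      by (simp add: mult_ac)
    also have "\<dots> = (?r' i * (\<Prod>x<n. ?c (k x))) * (vertex_weight q s v (a n) i (k n) j * ?c (k n))"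
      by (simp only: Suc.IH conj_weight_eq[OF assms])
    finally show ?thesis by (simp add: mult_ac)
  qed
  then show ?case unfolding row_weight.simps distrib_right by (simp only:)
qed simp

lemma conj_row_total:
  assumes "qpoch q q M \<noteq> 0" "1 - s * v \<noteq> 0" "a \<in> occs M" "k \<in> occs M"
  shows "conj_occ q s a * row_total (conj_weight q s v) e a k =
    row_total (vertex_weight q s v) e a k * conj_occ q s k"
proof -
  obtain n' where "a \<in> occ_below M n'" using occs_belowE[OF assms(3)] .
  moreover obtain n where k: "k \<in> occ_below M n" "n \<ge> n'" using occs_belowE[OF assms(4)] .
  ultimately have a: "a \<in> occ_below M n" using occ_below_mono by blast
  interpret W: ice_weight "vertex_weight q s v" using assms(2) by (rule ice_weight_vertex_weight)
  interpret C: ice_weight "conj_weight q s v" using assms(2) by (rule ice_weight_conj_weight)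
  have z: "\<forall>x\<ge>n. a x = 0" "\<forall>x\<ge>n. k x = 0" using a k by (auto simp: occ_below_def)
  then have "row_total (conj_weight q s v) e a k = row_weight (conj_weight q s v) e a k n 0"
    "row_total (vertex_weight q s v) e a k = row_weight (vertex_weight q s v) e a k n 0"
    by (auto intro!: W.row_total_eq C.row_total_eq)
  then show ?thesis
    using conj_row_weight[where a = a and k = k and n = n and j = 0,
        OF assms(1) occs_le[OF assms(3)] occs_le[OF assms(4)]]
    by (simp add: conj_occ_below[OF z(1)] conj_occ_below[OF z(2)] mult.commute)
qed

text \<open>The factors at the intermediate occupations \<open>t\<close> cancel between consecutive
  rows, and only those at the two ends remain.\<close>

lemma G_rows_conj:
  assumes "qpoch q q M \<noteq> 0" "\<And>j. j \<in> {1..N} \<Longrightarrow> 1 - s * v j \<noteq> 0" "f \<in> occs M"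
  shows "conj_occ q s (pile M) * G_rows q s v M N f =
    iterate_rows (\<lambda>j. vertex_weight q s (v j)) 0 M (pile M) N f * conj_occ q s f"
  using assms(2,3)
proof (induction N arbitrary: f)
  case (Suc N)
  let ?I = "iterate_rows (\<lambda>j. vertex_weight q s (v j)) 0 M (pile M) N"
  have "conj_occ q s (pile M) * G_rows q s v M (Suc N) f = (\<Sum>\<^sub>\<infinity>t\<in>occs M.
      (conj_occ q s (pile M) * G_rows q s v M N t) * row_total (conj_weight q s (v (Suc N))) 0 t f)"
    unfolding G_rows_Suc infsum_cmult_right'[symmetric] by (simp only: mult.assoc)
  also have "\<dots> = (\<Sum>\<^sub>\<infinity>t\<in>occs M. ?I t * row_total (vertex_weight q s (v (Suc N))) 0 t f * conj_occ q s f)"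
  proof (rule infsum_cong)
    fix t assume t: "t \<in> occs M"
    have "conj_occ q s (pile M) * G_rows q s v M N t = ?I t * conj_occ q s t"
      using Suc.prems t by (intro Suc.IH) auto
    moreover have "conj_occ q s t * row_total (conj_weight q s (v (Suc N))) 0 t f =
        row_total (vertex_weight q s (v (Suc N))) 0 t f * conj_occ q s f"
      using Suc.prems t by (intro conj_row_total[OF assms(1)]) auto
    ultimately show "(conj_occ q s (pile M) * G_rows q s v M N t) * row_total (conj_weight q s (v (Suc N))) 0 t f
        = ?I t * row_total (vertex_weight q s (v (Suc N))) 0 t f * conj_occ q s f"
      by (simp only: mult.assoc)
  qed
  also have "\<dots> = iterate_rows (\<lambda>j. vertex_weight q s (v j)) 0 M (pile M) (Suc N) f * conj_occ q s f"
    by (simp add: infsum_cmult_left')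
  finally show ?case .
qed simp

lemma conj_factor_eq:
  assumes "\<kappa> \<in> Sign_plus L"
  shows "conj_factor q s \<kappa> = conj_occ q s (occ \<kappa>)"
  unfolding conj_factor_def conj_occ_def
proof (rule prod.reindex_bij_witness[where i = int and j = nat])
  fix z assume "z \<in> set \<kappa>"
  moreover from this have "z \<ge> 0" using assms by (auto simp: Sign_plus_def)
  ultimately show "int (nat z) = z" "nat z \<in> {x. occ \<kappa> x \<noteq> 0}"
    "conj_term q s (occ \<kappa> (nat z)) = qpoch (s\<^sup>2) q (count_list \<kappa> z) / qpoch q q (count_list \<kappa> z)"
    by (auto simp: occ_def count_list_0_iff conj_term_def)
qed (auto simp: occ_def count_list_0_iff)

lemma occ_replicate_0: "occ (replicate M 0) = pile M"
  by (auto simp: occ_def pile_def fun_eq_iff simp flip: count_mset)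

lemma replicate_0_Sign_plus: "replicate M 0 \<in> Sign_plus M"
  by (auto simp: Sign_plus_def Sign_def sorted_wrt_iff_nth_less)

lemma F_eq_F_rows:
  assumes "\<nu> \<in> Sign_plus M" "\<And>i. i \<in> {1..M} \<Longrightarrow> 1 - s * u i \<noteq> 0"
  shows "F q s \<nu> u = F_rows q s u M (occ \<nu>)"
proof -
  obtain n where below: "n > 0" "\<forall>x\<in>set \<nu>. x < int n" using Sign_plus_below by blast
  interpret path_rows "[]" 0 1 n
    using below by unfold_locales (auto simp: Sign_plus_def Sign_def)
  have "\<nu> \<in> Sign_plus (0 + 1 * M)" using assms(1) by simp
  from partition_function_eq_iterate_rows[OF this below(2) ice_weight_vertex_weight[OF assms(2)]]
  have "partition_function q s u (start_edges [] 1 M) (vertical_edges \<nu> (int M)) =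
      iterate_rows (\<lambda>i. vertex_weight q s (u i)) 1 0 (occ []) M (occ \<nu>)" .
  moreover have "occ [] = (\<lambda>_. 0)" by (simp add: occ_def fun_eq_iff)
  moreover have "length \<nu> = M" using assms(1) by (simp add: Sign_plus_def Sign_def)
  ultimately show ?thesis by (simp add: F_def F_skew_def start_edges_def)
qed

lemma Gc_eq_G_rows:
  assumes "\<nu> \<in> Sign_plus M" "\<And>j. j \<in> {1..N} \<Longrightarrow> 1 - s * v j \<noteq> 0"
    and "qpoch q q M \<noteq> 0" "qpoch (s\<^sup>2) q M \<noteq> 0"
  shows "Gc q s \<nu> N v = G_rows q s v M N (occ \<nu>)"
proof -
  obtain n where below: "n > 0" "\<forall>x\<in>set \<nu>. x < int n" using Sign_plus_below by blast
  interpret path_rows "replicate M 0" M 0 n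
    using below replicate_0_Sign_plus by unfold_locales auto
  have "\<nu> \<in> Sign_plus (M + 0 * N)" using assms(1) by simp
  from partition_function_eq_iterate_rows[OF this below(2) ice_weight_vertex_weight[OF assms(2)]]
  have "partition_function q s v (start_edges (replicate M 0) 0 N) (vertical_edges \<nu> (int N)) =
      iterate_rows (\<lambda>j. vertex_weight q s (v j)) 0 M (occ (replicate M 0)) N (occ \<nu>)" .
  moreover have "length \<nu> = M" using assms(1) by (simp add: Sign_plus_def Sign_def)
  ultimately have "Gc q s \<nu> N v = conj_occ q s (occ \<nu>) / conj_occ q s (pile M) *
      iterate_rows (\<lambda>j. vertex_weight q s (v j)) 0 M (pile M) N (occ \<nu>)"
    using conj_factor_eq[OF assms(1), of q s] conj_factor_eq[OF replicate_0_Sign_plus, of q s M]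
    by (simp add: Gc_def Gc_skew_def G_skew_def start_edges_def occ_replicate_0)
  \<comment> \<open>The only conjugation factor divided by is that of the signature
    \<open>(0, ..., 0)\<close>, whose numerator is \<open>qpoch (s\<^sup>2) q M\<close>.\<close>
  moreover have "conj_occ q s (pile M) \<noteq> 0"
  proof -
    have "conj_occ q s (pile M) = conj_term q s M"
      using conj_occ_below[of 1 "pile M" q s] by (simp add: pile_def)
    then show ?thesis using assms(3,4) by (simp add: conj_term_def)
  qed
  ultimately show ?thesis
    using G_rows_conj[where v = v and N = N, OF assms(3,2) occ_Sign_plus_occs[OF assms(1)]]
    by (metis (no_types, lifting) mult.commute nonzero_mult_div_cancel_left times_divide_eq_right)
qed

text \<open>The infinite sum of a family that is not summable is \<open>0\<close> by convention, so
  summability is asserted along with the value. The conditions other than the contraction say that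
  denominators do not vanish; \<open>1 - u i * v j\<close> is nonzero by the contraction.\<close>

theorem corollary4p7:
  fixes q s :: complex and M N :: nat and u v :: "nat \<Rightarrow> complex"
  assumes "qpoch q q M \<noteq> 0" and "qpoch (s\<^sup>2) q M \<noteq> 0"
    and "\<And>i. i \<in> {1..M} \<Longrightarrow> 1 - s * u i \<noteq> 0"
    and "\<And>j. j \<in> {1..N} \<Longrightarrow> 1 - s * v j \<noteq> 0"
    and "\<And>i j. i \<in> {1..M} \<Longrightarrow> j \<in> {1..N} \<Longrightarrow>
           norm ((u i - s) / (1 - s * u i) * ((v j - s) / (1 - s * v j))) < 1"
  shows "(\<lambda>\<nu>. F q s \<nu> u * Gc q s \<nu> N v) summable_on Sign_plus M \<and>
    (\<Prod>i\<in>{1..M}. 1 - s * u i) / qpoch q q M *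
      (\<Sum>\<^sub>\<infinity>\<nu>\<in>Sign_plus M. F q s \<nu> u * Gc q s \<nu> N v)
    = (\<Prod>i\<in>{1..M}. \<Prod>j\<in>{1..N}. (1 - q * u i * v j) / (1 - u i * v j))"
proof -
  interpret cauchy_variables q s M N u v by unfold_locales (use assms(3-5) in auto)
  let ?h = "\<lambda>k. F_rows q s u M k * G_rows q s v M N k"
  have eq: "F q s \<nu> u * Gc q s \<nu> N v = ?h (occ \<nu>)" if "\<nu> \<in> Sign_plus M" for \<nu>
    using F_eq_F_rows[OF that, of s u q] Gc_eq_G_rows[OF that, of N s v q] assms by simp
  have "(\<lambda>\<nu>. F q s \<nu> u * Gc q s \<nu> N v) summable_on Sign_plus M \<longleftrightarrow> (\<lambda>\<nu>. ?h (occ \<nu>)) summable_on Sign_plus M"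
    using eq by (rule summable_on_cong)
  also have "\<dots> \<longleftrightarrow> ?h summable_on occs M"
    by (rule summable_on_reindex_bij_betw[OF bij_betw_occ])
  finally have "(\<lambda>\<nu>. F q s \<nu> u * Gc q s \<nu> N v) summable_on Sign_plus M"
    using F_G_summable by simp
  moreover have "(\<Sum>\<^sub>\<infinity>\<nu>\<in>Sign_plus M. F q s \<nu> u * Gc q s \<nu> N v) = (\<Sum>\<^sub>\<infinity>\<nu>\<in>Sign_plus M. ?h (occ \<nu>))"
    using eq by (rule infsum_cong)
  moreover have "(\<Sum>\<^sub>\<infinity>\<nu>\<in>Sign_plus M. ?h (occ \<nu>)) = (\<Sum>\<^sub>\<infinity>k\<in>occs M. ?h k)"
    by (rule infsum_reindex_bij_betw[OF bij_betw_occ])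
  moreover have "(\<Sum>\<^sub>\<infinity>k\<in>occs M. ?h k) =
      (\<Prod>i\<in>{1..M}. \<Prod>j\<in>{1..N}. (1 - q * u i * v j) / (1 - u i * v j)) * F_rows q s u M (pile M)"
    by (rule F_G_rows_cauchy) unfold_locales
  moreover have "(\<Prod>i\<in>{1..M}. 1 - s * u i) / qpoch q q M * (X * F_rows q s u M (pile M)) = X" for X
    using F_rows_pile[OF assms(3), where M = M and q = q] assms(1) by (simp add: field_simps)
  ultimately show ?thesis by (simp only: simp_thms)
qed

end
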